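(* Let $A$ be an injective self-adjoint compact operator on $L^2[a,b]$ with eigenvalues $1\geqslant\lambda_1>\lambda_2>\lambda_3>\cdots>0$, $\lim_{k\to\infty}\lambda_k=0$, and let $\mathcal{E}=\{Af : f\in L^2[a,b],\ \|f\|_{L^2[a,b]}\leqslant 1\}$. For $\delta>0$ let $k_0(\delta)$ be the largest integer $k$ such that $\lambda_k\geqslant\delta$. Then for every $\varepsilon$ with $0<\varepsilon<\lambda_1$, the $\varepsilon$-entropy $H_\varepsilon(\mathcal{E})$ and the $\varepsilon/2$-entropy $H_{\varepsilon/2}(\mathcal{E})$ satisfy $$\sum_{k=1}^{k_0(\varepsilon)}\log\frac{\lambda_k}{\varepsilon}\leqslant H_\varepsilon(\mathcal{E}),\qquad H_{\varepsilon/2}(\mathcal{E})\leqslant k_0\left(\frac{\varepsilon}{4}\right)\left[\log\left(\frac1\varepsilon\right)+\log 6+\frac12\log k_0\left(\frac{\varepsilon}{4}\right)\right],$$ and consequently the $\varepsilon$-capacity $C_\varepsilon(\mathcal{E})$ satisfies $$\sum_{k=1}^{k_0(\varepsilon)}\log\frac{\lambda_k}{\varepsilon}\leqslant C_\varepsilon(\mathcal{E})\leqslant k_0\left(\frac{\varepsilon}{4}\right)\left[\log\left(\frac1\varepsilon\right)+\log 6+\frac12\log k_0\left(\frac{\varepsilon}{4}\right)\right].$$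
   Context: $\log$ denotes the logarithm to base 2. Put $Y=L^2[a,b]$. The eigenvalues of $A$ are simple, and the corresponding eigenfunctions $\{\psi_k\}_{k\geqslant 1}$ form an orthonormal basis of $L^2[a,b]$. For $\varepsilon>0$, a finite family $Y_1,\dots,Y_n$ of subsets of $Y$ is an $\varepsilon$-covering of $\mathcal{E}$ if each $Y_k$ has diameter not exceeding $2\varepsilon$ and $\mathcal{E}\subset\bigcup_{k=1}^n Y_k$. $N_\varepsilon(\mathcal{E})$ is the minimal number $n$ of sets in an $\varepsilon$-covering of $\mathcal{E}$, and the $\varepsilon$-entropy is $H_\varepsilon(\mathcal{E})=\log N_\varepsilon(\mathcal{E})$. Points $y_1,\dots,y_m\in\mathcal{E}$ are called $\varepsilon$-distinguishable if the distance in $Y$ between each two of them exceeds $\varepsilon$. $M_\varepsilon(\mathcal{E})$ is the maximal number $m$ of $\varepsilon$-distinguishable points of $\mathcal{E}$, and the $\varepsilon$-capacity is $C_\varepsilon(\mathcal{E})=\log M_\varepsilon(\mathcal{E})$. *)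

theory Defs
  imports "HOL-Analysis.Analysis"
begin

text \<open>
  Elements of the real Hilbert space \<open>L\<^sup>2[a,b]\<close> are represented by square-integrable functions
  on \<open>{a..b}\<close>; equality in \<open>L\<^sup>2[a,b]\<close> is equality almost everywhere. Norms, distances,
  covering numbers and packing numbers of sets of representatives agree with those of the
  corresponding sets of equivalence classes.
\<close>

definition L2 :: "real \<Rightarrow> real \<Rightarrow> (real \<Rightarrow> real) set" where
  "L2 a b = {f. f \<in> borel_measurable (lebesgue_on {a..b}) \<and>
                integrable (lebesgue_on {a..b}) (\<lambda>x. (f x)\<^sup>2)}"

definition l2_eq :: "real \<Rightarrow> real \<Rightarrow> (real \<Rightarrow> real) \<Rightarrow> (real \<Rightarrow> real) \<Rightarrow> bool" where
  "l2_eq a b f g \<longleftrightarrow> (AE x in lebesgue_on {a..b}. f x = g x)"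

definition l2_inner :: "real \<Rightarrow> real \<Rightarrow> (real \<Rightarrow> real) \<Rightarrow> (real \<Rightarrow> real) \<Rightarrow> real" where
  "l2_inner a b f g = (\<integral>x. f x * g x \<partial>(lebesgue_on {a..b}))"

definition l2_norm :: "real \<Rightarrow> real \<Rightarrow> (real \<Rightarrow> real) \<Rightarrow> real" where
  "l2_norm a b f = sqrt (l2_inner a b f f)"

definition l2_dist :: "real \<Rightarrow> real \<Rightarrow> (real \<Rightarrow> real) \<Rightarrow> (real \<Rightarrow> real) \<Rightarrow> real" where
  "l2_dist a b f g = l2_norm a b (\<lambda>x. f x - g x)"

definition l2_diameter :: "real \<Rightarrow> real \<Rightarrow> (real \<Rightarrow> real) set \<Rightarrow> ennreal" where
  "l2_diameter a b S = (SUP f\<in>S. SUP g\<in>S. ennreal (l2_dist a b f g))"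

text \<open>
  Linear operators defined on all of \<open>L\<^sup>2[a,b]\<close>. The second clause says that \<open>A\<close> descends to
  equivalence classes. Boundedness is part of \<open>l2_compact\<close>.
\<close>

definition l2_linear :: "real \<Rightarrow> real \<Rightarrow> ((real \<Rightarrow> real) \<Rightarrow> (real \<Rightarrow> real)) \<Rightarrow> bool" where
  "l2_linear a b A \<longleftrightarrow>
     (\<forall>f\<in>L2 a b. A f \<in> L2 a b) \<and>
     (\<forall>f\<in>L2 a b. \<forall>g\<in>L2 a b. l2_eq a b f g \<longrightarrow> l2_eq a b (A f) (A g)) \<and>
     (\<forall>f\<in>L2 a b. \<forall>g\<in>L2 a b. l2_eq a b (A (\<lambda>x. f x + g x)) (\<lambda>x. A f x + A g x)) \<and>
     (\<forall>c. \<forall>f\<in>L2 a b. l2_eq a b (A (\<lambda>x. c * f x)) (\<lambda>x. c * A f x))"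

definition l2_self_adjoint :: "real \<Rightarrow> real \<Rightarrow> ((real \<Rightarrow> real) \<Rightarrow> (real \<Rightarrow> real)) \<Rightarrow> bool" where
  "l2_self_adjoint a b A \<longleftrightarrow>
     (\<forall>f\<in>L2 a b. \<forall>g\<in>L2 a b. l2_inner a b (A f) g = l2_inner a b f (A g))"

definition l2_compact :: "real \<Rightarrow> real \<Rightarrow> ((real \<Rightarrow> real) \<Rightarrow> (real \<Rightarrow> real)) \<Rightarrow> bool" where
  "l2_compact a b A \<longleftrightarrow>
     (\<forall>f :: nat \<Rightarrow> real \<Rightarrow> real.
        (\<forall>n. f n \<in> L2 a b) \<and> (\<exists>B. \<forall>n. l2_norm a b (f n) \<le> B) \<longrightarrow>
        (\<exists>r g. strict_mono (r :: nat \<Rightarrow> nat) \<and> g \<in> L2 a b \<and>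
               (\<lambda>n. l2_dist a b (A (f (r n))) g) \<longlonglongrightarrow> 0))"

definition l2_injective :: "real \<Rightarrow> real \<Rightarrow> ((real \<Rightarrow> real) \<Rightarrow> (real \<Rightarrow> real)) \<Rightarrow> bool" where
  "l2_injective a b A \<longleftrightarrow>
     (\<forall>f\<in>L2 a b. \<forall>g\<in>L2 a b. l2_eq a b (A f) (A g) \<longrightarrow> l2_eq a b f g)"

definition l2_eigenfunction ::
    "real \<Rightarrow> real \<Rightarrow> ((real \<Rightarrow> real) \<Rightarrow> (real \<Rightarrow> real)) \<Rightarrow> real \<Rightarrow> (real \<Rightarrow> real) \<Rightarrow> bool" where
  "l2_eigenfunction a b A \<mu> f \<longleftrightarrow>
     f \<in> L2 a b \<and> \<not> l2_eq a b f (\<lambda>x. 0) \<and> l2_eq a b (A f) (\<lambda>x. \<mu> * f x)"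

definition l2_eigenvalue ::
    "real \<Rightarrow> real \<Rightarrow> ((real \<Rightarrow> real) \<Rightarrow> (real \<Rightarrow> real)) \<Rightarrow> real \<Rightarrow> bool" where
  "l2_eigenvalue a b A \<mu> \<longleftrightarrow> (\<exists>f. l2_eigenfunction a b A \<mu> f)"

definition l2_simple_eigenvalue ::
    "real \<Rightarrow> real \<Rightarrow> ((real \<Rightarrow> real) \<Rightarrow> (real \<Rightarrow> real)) \<Rightarrow> real \<Rightarrow> bool" where
  "l2_simple_eigenvalue a b A \<mu> \<longleftrightarrow>
     l2_eigenvalue a b A \<mu> \<and>
     (\<forall>f g. l2_eigenfunction a b A \<mu> f \<and> l2_eigenfunction a b A \<mu> g \<longrightarrow>
            (\<exists>c. l2_eq a b g (\<lambda>x. c * f x)))"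

text \<open>Sequences of eigenvalues and eigenfunctions are indexed by \<open>k \<ge> 1\<close>; the value at \<open>0\<close> is unused.\<close>

definition l2_orthonormal_basis :: "real \<Rightarrow> real \<Rightarrow> (nat \<Rightarrow> real \<Rightarrow> real) \<Rightarrow> bool" where
  "l2_orthonormal_basis a b \<psi> \<longleftrightarrow>
     (\<forall>k\<ge>1. \<psi> k \<in> L2 a b) \<and>
     (\<forall>j\<ge>1. \<forall>k\<ge>1. l2_inner a b (\<psi> j) (\<psi> k) = (if j = k then 1 else 0)) \<and>
     (\<forall>f\<in>L2 a b. (\<lambda>n. l2_dist a b f (\<lambda>x. \<Sum>k=1..n. l2_inner a b f (\<psi> k) * \<psi> k x)) \<longlonglongrightarrow> 0)"

definition unit_ball_image ::
    "real \<Rightarrow> real \<Rightarrow> ((real \<Rightarrow> real) \<Rightarrow> (real \<Rightarrow> real)) \<Rightarrow> (real \<Rightarrow> real) set" where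
  "unit_ball_image a b A = {A f | f. f \<in> L2 a b \<and> l2_norm a b f \<le> 1}"

definition eps_covering ::
    "real \<Rightarrow> real \<Rightarrow> real \<Rightarrow> (real \<Rightarrow> real) set \<Rightarrow> nat \<Rightarrow> (nat \<Rightarrow> (real \<Rightarrow> real) set) \<Rightarrow> bool" where
  "eps_covering a b \<epsilon> E n Y \<longleftrightarrow>
     (\<forall>k\<in>{1..n}. Y k \<subseteq> L2 a b \<and> l2_diameter a b (Y k) \<le> ennreal (2 * \<epsilon>)) \<and>
     E \<subseteq> (\<Union>k\<in>{1..n}. Y k)"

definition eps_distinguishable ::
    "real \<Rightarrow> real \<Rightarrow> real \<Rightarrow> (real \<Rightarrow> real) set \<Rightarrow> nat \<Rightarrow> (nat \<Rightarrow> real \<Rightarrow> real) \<Rightarrow> bool" where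
  "eps_distinguishable a b \<epsilon> E m y \<longleftrightarrow>
     (\<forall>i\<in>{1..m}. y i \<in> E) \<and>
     (\<forall>i\<in>{1..m}. \<forall>j\<in>{1..m}. i \<noteq> j \<longrightarrow> l2_dist a b (y i) (y j) > \<epsilon>)"

text \<open>
  The minimum and maximum below are attained for totally bounded nonempty \<open>E\<close> and \<open>\<epsilon> > 0\<close>,
  in particular for the image of the unit ball under a compact operator.
\<close>

definition covering_number :: "real \<Rightarrow> real \<Rightarrow> real \<Rightarrow> (real \<Rightarrow> real) set \<Rightarrow> nat" where
  "covering_number a b \<epsilon> E = (LEAST n. \<exists>Y. eps_covering a b \<epsilon> E n Y)"

definition packing_number :: "real \<Rightarrow> real \<Rightarrow> real \<Rightarrow> (real \<Rightarrow> real) set \<Rightarrow> nat" where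
  "packing_number a b \<epsilon> E = (GREATEST m. \<exists>y. eps_distinguishable a b \<epsilon> E m y)"

definition eps_entropy :: "real \<Rightarrow> real \<Rightarrow> real \<Rightarrow> (real \<Rightarrow> real) set \<Rightarrow> real" where
  "eps_entropy a b \<epsilon> E = log 2 (real (covering_number a b \<epsilon> E))"

definition eps_capacity :: "real \<Rightarrow> real \<Rightarrow> real \<Rightarrow> (real \<Rightarrow> real) set \<Rightarrow> real" where
  "eps_capacity a b \<epsilon> E = log 2 (real (packing_number a b \<epsilon> E))"

text \<open>Meaningful for null sequences \<open>lam\<close> and \<open>0 < \<delta> \<le> lam 1\<close>, where the maximum exists.\<close>

definition k0 :: "(nat \<Rightarrow> real) \<Rightarrow> real \<Rightarrow> nat" where
  "k0 lam \<delta> = (GREATEST k. k \<ge> 1 \<and> lam k \<ge> \<delta>)"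

end

theory Submission
  imports Defs
begin

text \<open>
  In the coordinates of the eigenfunctions, the image of the unit ball is the ellipsoid
  \<open>\<Sum>k. (x k / lam k)\<^sup>2 \<le> 1\<close> in sequence space. Everything follows from the chain
  
    lower bound \<open>\<le>\<close> \<open>\<epsilon>\<close>-entropy \<open>\<le>\<close> \<open>\<epsilon>\<close>-capacity \<open>\<le>\<close> \<open>\<epsilon>/2\<close>-entropy \<open>\<le>\<close> upper bound.
  
  The two inner inequalities (\<open>covering_packing_sandwich\<close>) are general: the \<open>\<epsilon>\<close>-balls around a maximal
  \<open>\<epsilon>\<close>-distinguishable family form an \<open>\<epsilon>\<close>-covering, and a set of diameter at most \<open>\<epsilon>\<close> contains at most one point of such
  a family.
  
  The lower bound (\<open>covering_lower_bound\<close>) compares volumes in the first \<open>n\<close> coordinates, with \<open>n\<close> the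
  number of eigenvalues that are at least \<open>\<epsilon>\<close>. The ellipsoid
  has \<open>\<Prod>k\<le>n. lam k\<close> times the volume of the unit ball. A covering set has diameter at most \<open>2 * \<epsilon>\<close> but
  need not lie in a ball of radius \<open>\<epsilon>\<close>, so the isodiametric inequality is needed to bound
  its volume by \<open>\<epsilon> ^ n\<close> times the volume of the unit ball. It is derived from the multiplicative
  Prekopa-Leindler inequality, which is proved by induction on the dimension from the Brunn-Minkowski
  inequality on the line. As the dimension varies, Euclidean space is represented by finite products
  of the Lebesgue measure.
  
  The upper bound (\<open>covering_upper_bound\<close>) cuts off the coordinates with \<open>lam k < \<epsilon> / 4\<close>, which
  contribute at most \<open>\<epsilon> / 2\<close> to any distance, and covers the others by a cubical grid.
\<close>

section \<open>The Prekopa-Leindler inequality\<close>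

text \<open>
  Move \<open>A\<close> by a point \<open>q\<close> near \<open>Inf B\<close> and \<open>B\<close> by a point \<open>p\<close> near \<open>Sup A\<close>. Both
  translates lie in \<open>2 C\<close>, and they overlap only in an interval whose length is as small as desired,
  so their measures add up.
\<close>

lemma Brunn_Minkowski_real_midpoint:
  fixes A B C :: "real set"
  assumes [measurable]: "A \<in> sets borel" "B \<in> sets borel" "C \<in> sets borel"
    and ne: "A \<noteq> {}" "B \<noteq> {}" and bd: "bounded A" "bounded B"
    and C: "\<And>x y. x \<in> A \<Longrightarrow> y \<in> B \<Longrightarrow> (x + y) / 2 \<in> C"
  shows "emeasure lborel A + emeasure lborel B \<le> 2 * emeasure lborel C"
proof -
  define D where "D = {z. z / 2 \<in> C}"
  have D [measurable]: "D \<in> sets borel" unfolding D_def by measurable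
  have shift: "emeasure lborel {z. z - t \<in> X} = emeasure lborel X" 
    if [measurable]: "X \<in> sets borel" for X and t :: real
  proof -
    have "emeasure lborel {z. z - t \<in> X} = (\<integral>\<^sup>+z. indicator {z. z - t \<in> X} z \<partial>lborel)"
      by simp
    also have "\<dots> = (\<integral>\<^sup>+z. indicator X (z - t) \<partial>lborel)"
      by (intro nn_integral_cong) (simp add: indicator_def)
    also have "\<dots> = (\<integral>\<^sup>+z. indicator X z \<partial>lborel)"
      by (subst nn_integral_real_affine[where c=1 and t=t]) auto
    finally show ?thesis by simp
  qed
  have "emeasure lborel D = (\<integral>\<^sup>+z. indicator D z \<partial>lborel)"
    by simp
  also have "\<dots> = (\<integral>\<^sup>+z. indicator C (z / 2) \<partial>lborel)"
    by (intro nn_integral_cong) (simp add: indicator_def D_def)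
  also have "\<dots> = 2 * (\<integral>\<^sup>+z. indicator C z \<partial>lborel)"
    by (subst nn_integral_real_affine[where c=2 and t=0]) auto
  finally have DC: "emeasure lborel D = 2 * emeasure lborel C" by simp
  have "emeasure lborel A + emeasure lborel B \<le> emeasure lborel D + ennreal e" if "e > 0" for e
  proof -
    have "Sup A - e / 2 < Sup A" using that by simp
    from less_cSupD[OF ne(1) this] obtain p where p: "p \<in> A" "p > Sup A - e / 2" by blast
    have "Inf B < Inf B + e / 2" using that by simp
    from cInf_lessD[OF ne(2) this] obtain q where q: "q \<in> B" "q < Inf B + e / 2" by blast
    define S where "S = {z. z - q \<in> A}"
    define T where "T = {z. z - p \<in> B}"
    have [measurable]: "S \<in> sets borel" "T \<in> sets borel" unfolding S_def T_def by measurable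
    have "S \<union> T \<subseteq> D"
    proof
      fix z assume "z \<in> S \<union> T"
      then show "z \<in> D"
      proof
        assume "z \<in> S" then show ?thesis using C[of "z - q" q] q(1) by (simp add: S_def D_def)
      next
        assume "z \<in> T" then show ?thesis using C[of p "z - p"] p(1) by (simp add: T_def D_def)
      qed
    qed
    then have 1: "emeasure lborel (S \<union> T) \<le> emeasure lborel D"
      by (intro emeasure_mono) auto
    have "S \<inter> T \<subseteq> {p + Inf B .. Sup A + q}"
    proof
      fix z assume "z \<in> S \<inter> T"
      then have "z - q \<le> Sup A" "Inf B \<le> z - p"
        using bd by (auto simp: S_def T_def bounded_imp_bdd_above bounded_imp_bdd_below cSup_upper cInf_lower)
      then show "z \<in> {p + Inf B .. Sup A + q}" by auto
    qed
    then have "emeasure lborel (S \<inter> T) \<le> emeasure lborel {p + Inf B .. Sup A + q}"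
      by (intro emeasure_mono) auto
    also have "\<dots> \<le> ennreal e"
      using p q that by (auto simp: emeasure_lborel_Icc_eq intro!: ennreal_leI)
    finally have 2: "emeasure lborel (S \<inter> T) \<le> ennreal e" .
    have "emeasure lborel A + emeasure lborel B = emeasure lborel S + emeasure lborel T"
      unfolding S_def T_def by (simp add: shift)
    also have "\<dots> = emeasure lborel (S \<union> T) + emeasure lborel (S \<inter> T)"
      by (intro emeasure_Un_Int) auto
    finally show ?thesis using 1 2 by (simp add: add_mono)
  qed
  then show ?thesis unfolding DC by (rule ennreal_le_epsilon)
qed

lemma nn_integral_layer_cake:
  fixes f :: "real \<Rightarrow> ennreal"
  assumes [measurable]: "f \<in> borel_measurable borel"
  shows "(\<integral>\<^sup>+x. f x \<partial>lborel) =
    (\<integral>\<^sup>+t. indicator {0..} t * emeasure lborel {x. ennreal t < f x} \<partial>lborel)"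
proof -
  have "f x = (\<integral>\<^sup>+t. indicator {t. 0 \<le> t \<and> ennreal t < f x} t \<partial>lborel)" for x
  proof (cases "f x")
    case (real r)
    then have "{t. 0 \<le> t \<and> ennreal t < f x} = {0..<r}" by (auto simp: ennreal_less_iff)
    with real show ?thesis by simp
  next
    case top
    have "\<not> emeasure lborel {0::real..} \<le> ennreal r" for r
    proof
      assume "emeasure lborel {0::real..} \<le> ennreal r"
      moreover have "emeasure lborel {0 .. \<bar>r\<bar> + 1} \<le> emeasure lborel {0::real..}"
        by (intro emeasure_mono) auto
      moreover have "emeasure lborel {0 .. \<bar>r\<bar> + 1} = ennreal (\<bar>r\<bar> + 1 - 0)"
        by (rule emeasure_lborel_Icc) simp
      ultimately have "ennreal (\<bar>r\<bar> + 1 - 0) \<le> ennreal r" by order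
      then show False unfolding ennreal_le_iff2 by linarith
    qed
    then have "emeasure lborel {0::real..} = top"
      by (cases "emeasure lborel {0::real..}") auto
    moreover have "{t. 0 \<le> t \<and> ennreal t < f x} = {0..}" using top by auto
    ultimately show ?thesis using top by simp
  qed
  then have "(\<integral>\<^sup>+x. f x \<partial>lborel) = 
     (\<integral>\<^sup>+x. (\<integral>\<^sup>+t. indicator {t. 0 \<le> t \<and> ennreal t < f x} t \<partial>lborel) \<partial>lborel)"
    by (intro nn_integral_cong) auto
  also have "\<dots> = (\<integral>\<^sup>+t. (\<integral>\<^sup>+x. indicator {t. 0 \<le> t \<and> ennreal t < f x} t \<partial>lborel) \<partial>lborel)"
    by (intro lborel_pair.Fubini') measurable
  also have "\<dots> = (\<integral>\<^sup>+t. indicator {0..} t * emeasure lborel {x. ennreal t < f x} \<partial>lborel)"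
  proof (intro nn_integral_cong)
    fix t :: real
    have "(\<integral>\<^sup>+x. indicator {t. 0 \<le> t \<and> ennreal t < f x} t \<partial>lborel) =
       (\<integral>\<^sup>+x. indicator {0..} t * indicator {x. ennreal t < f x} x \<partial>lborel)"
      by (intro nn_integral_cong) (auto simp: indicator_def)
    then show "(\<integral>\<^sup>+x. indicator {t. 0 \<le> t \<and> ennreal t < f x} t \<partial>lborel) =
       indicator {0..} t * emeasure lborel {x. ennreal t < f x}"
      by (simp add: nn_integral_cmult)
  qed
  finally show ?thesis .
qed

text \<open>
  The inequality of the arithmetic and geometric means, which turns the additive one-dimensional
  estimate into a multiplicative one.
\<close>

lemma ennreal_mult_le_square_if_add_le:
  fixes a b c :: ennreal
  assumes "a + b \<le> 2 * c" shows "a * b \<le> c\<^sup>2"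
proof (cases "c = top")
  case False
  then have "2 * c < top" by (simp add: ennreal_mult_less_top less_top)
  with assms have "a < top" "b < top" by (auto simp: less_top[symmetric] top_unique)
  then obtain x y z where xyz: "a = ennreal x" "b = ennreal y" "c = ennreal z" "x \<ge> 0" "y \<ge> 0" "z \<ge> 0"
    using False by (metis ennreal_cases less_top)
  with assms have "x + y \<le> 2 * z"
    by (simp flip: ennreal_plus ennreal_mult ennreal_numeral)
  then have "(x + y)\<^sup>2 \<le> (2 * z)\<^sup>2" using xyz by (intro power_mono) auto
  moreover have "0 \<le> (x - y)\<^sup>2" by simp
  ultimately have "x * y \<le> z\<^sup>2" unfolding power2_eq_square by (simp add: algebra_simps)
  then have "ennreal (x * y) \<le> ennreal (z\<^sup>2)" by (rule ennreal_leI)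
  then show ?thesis using xyz by (simp only: ennreal_mult ennreal_power)
qed (simp add: power2_eq_square)

text \<open>
  When both suprema equal 1, the superlevel sets of \<open>f\<close> and \<open>g\<close> at a height \<open>t < 1\<close> are both nonempty,
  so that the Brunn-Minkowski inequality applies at every such height, and at heights \<open>t \<ge> 1\<close>
  the sets are both empty. Integration over \<open>t\<close> gives the claim.
\<close>

lemma Prekopa_Leindler_real_sup1:
  fixes f g h :: "real \<Rightarrow> ennreal"
  assumes [measurable]: "f \<in> borel_measurable borel" "g \<in> borel_measurable borel" "h \<in> borel_measurable borel"
    and sup: "(SUP x. f x) = 1" "(SUP x. g x) = 1"
    and bd: "bounded {x. f x \<noteq> 0}" "bounded {x. g x \<noteq> 0}"
    and h: "\<And>x y t. t < f x \<Longrightarrow> t < g y \<Longrightarrow> t < h ((x + y) / 2)"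
  shows "(\<integral>\<^sup>+x. f x \<partial>lborel) + (\<integral>\<^sup>+x. g x \<partial>lborel) \<le> 2 * (\<integral>\<^sup>+x. h x \<partial>lborel)"
proof -
  have level: "emeasure lborel {x. ennreal t < f x} + emeasure lborel {x. ennreal t < g x}
      \<le> 2 * emeasure lborel {x. ennreal t < h x}" if "t \<ge> 0" for t
  proof (cases "t < 1")
    case True
    then have t1: "ennreal t < 1" using that by (simp add: ennreal_less_one_iff)
    show ?thesis
    proof (rule Brunn_Minkowski_real_midpoint)
      show "{x. ennreal t < f x} \<noteq> {}" "{x. ennreal t < g x} \<noteq> {}"
        using t1 sup less_SUP_iff[of "ennreal t" f UNIV] less_SUP_iff[of "ennreal t" g UNIV] by auto
      show "bounded {x. ennreal t < f x}" "bounded {x. ennreal t < g x}"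
        by (rule bounded_subset[OF bd(1)], force) (rule bounded_subset[OF bd(2)], force)
      show "(x + y) / 2 \<in> {x. ennreal t < h x}"
        if "x \<in> {x. ennreal t < f x}" "y \<in> {x. ennreal t < g x}" for x y
        using h[of "ennreal t" x y] that by simp
    qed measurable
  next
    case False
    then have t1: "1 \<le> ennreal t" by simp
    have "f x \<le> ennreal t" "g x \<le> ennreal t" for x
      using order_trans[OF SUP_upper[of x UNIV f, unfolded sup] t1]
        order_trans[OF SUP_upper[of x UNIV g, unfolded sup] t1] by auto
    then have "{x. ennreal t < f x} = {}" "{x. ennreal t < g x} = {}"
      by (auto simp: not_less)
    then show ?thesis by simp
  qed
  have "(\<integral>\<^sup>+x. f x \<partial>lborel) + (\<integral>\<^sup>+x. g x \<partial>lborel) =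
    (\<integral>\<^sup>+t. indicator {0..} t * emeasure lborel {x. ennreal t < f x} +
       indicator {0..} t * emeasure lborel {x. ennreal t < g x} \<partial>lborel)"
    by (subst nn_integral_add) (auto simp: nn_integral_layer_cake[of f] nn_integral_layer_cake[of g])
  also have "\<dots> \<le> (\<integral>\<^sup>+t. 2 * (indicator {0..} t * emeasure lborel {x. ennreal t < h x}) \<partial>lborel)"
    by (intro nn_integral_mono) (auto simp: indicator_def level)
  also have "\<dots> = 2 * (\<integral>\<^sup>+x. h x \<partial>lborel)"
    by (subst nn_integral_cmult) (auto simp: nn_integral_layer_cake[of h])
  finally show ?thesis .
qed


text \<open>
  For \<open>t = 0\<close> strict monotonicity of multiplication by \<open>t\<close> fails, hence the separate case.
\<close>

lemma ennreal_square_less_mult: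
  fixes a b t :: ennreal
  assumes "t < a" "t < b" shows "t * t < a * b"
proof (cases "t = 0")
  case False
  from assms(1) top_greatest have "t < top" by (rule less_le_trans)
  with False assms have "t * t < t * b"
    by (intro ennreal_mult_strict_left_mono) (auto simp: zero_less_iff_neq_zero)
  also have "\<dots> \<le> a * b" using assms by (intro mult_right_mono) auto
  finally show ?thesis .
qed (use assms in \<open>auto simp: ennreal_zero_less_mult_iff\<close>)

text \<open>
  Dividing \<open>f\<close> and \<open>g\<close> by their suprema \<open>F\<close> and \<open>G\<close>, and \<open>h\<close> by the geometric mean \<open>S\<close> of the two,
  preserves the hypothesis and makes both suprema equal to 1.
\<close>

lemma Prekopa_Leindler_real_bounded:
  fixes f g h :: "real \<Rightarrow> ennreal"
  assumes [measurable]: "f \<in> borel_measurable borel" "g \<in> borel_measurable borel" "h \<in> borel_measurable borel"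
    and fin: "(SUP x. f x) < top" "(SUP x. g x) < top"
    and bd: "bounded {x. f x \<noteq> 0}" "bounded {x. g x \<noteq> 0}"
    and h: "\<And>x y. f x * g y \<le> (h ((x + y) / 2))\<^sup>2"
  shows "(\<integral>\<^sup>+x. f x \<partial>lborel) * (\<integral>\<^sup>+x. g x \<partial>lborel) \<le> (\<integral>\<^sup>+x. h x \<partial>lborel)\<^sup>2"
proof -
  define F where "F = enn2real (SUP x. f x)"
  define G where "G = enn2real (SUP x. g x)"
  have F: "(SUP x. f x) = ennreal F" and G: "(SUP x. g x) = ennreal G"
    using fin by (auto simp: F_def G_def ennreal_enn2real)
  have FG0: "F \<ge> 0" "G \<ge> 0" by (auto simp: F_def G_def)
  have fF: "f x \<le> ennreal F" and gG: "g x \<le> ennreal G" for x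
    unfolding F[symmetric] G[symmetric] by (auto intro: SUP_upper)
  show ?thesis
  proof (cases "F = 0 \<or> G = 0")
    case True
    then have "(\<forall>x. f x = 0) \<or> (\<forall>x. g x = 0)" using fF gG by auto
    then show ?thesis by auto
  next
    case False
    with FG0 have pos: "F > 0" "G > 0" by auto
    define S where "S = sqrt (F * G)"
    have S: "S > 0" "S * S = F * G" using pos by (auto simp: S_def)
    have scale: "ennreal K * (ennreal (1 / K) * e) = e" if "K > 0" for K e
    proof -
      have "ennreal K * ennreal (1 / K) = 1" using that by (simp flip: ennreal_mult)
      then show ?thesis by (simp flip: mult.assoc)
    qed
    let ?f = "\<lambda>x. ennreal (1 / F) * f x" and ?g = "\<lambda>x. ennreal (1 / G) * g x" 
      and ?h = "\<lambda>x. ennreal (1 / S) * h x"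
    have "(\<integral>\<^sup>+x. ?f x \<partial>lborel) + (\<integral>\<^sup>+x. ?g x \<partial>lborel) \<le> 2 * (\<integral>\<^sup>+x. ?h x \<partial>lborel)"
    proof (rule Prekopa_Leindler_real_sup1)
      show "(SUP x. ?f x) = 1" "(SUP x. ?g x) = 1"
        using pos by (simp_all add: F G SUP_mult_left_ennreal[symmetric] flip: ennreal_mult)
      show "bounded {x. ?f x \<noteq> 0}" "bounded {x. ?g x \<noteq> 0}"
        by (rule bounded_subset[OF bd(1)], force) (rule bounded_subset[OF bd(2)], force)
      fix x y t assume t: "t < ?f x" "t < ?g y"
      show "t < ?h ((x + y) / 2)"
      proof (rule ccontr)
        assume "\<not> ?thesis"
        then have "(?h ((x + y) / 2))\<^sup>2 \<le> t\<^sup>2" by (intro power_mono) auto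
        also have "t\<^sup>2 < ?f x * ?g y"
          unfolding power2_eq_square using t by (rule ennreal_square_less_mult)
        also have "\<dots> = ennreal (1 / S) * ennreal (1 / S) * (f x * g y)"
        proof -
          have "ennreal (1 / F) * ennreal (1 / G) = ennreal (1 / S) * ennreal (1 / S)"
            using pos S by (simp flip: ennreal_mult)
          moreover have "?f x * ?g y = (ennreal (1 / F) * ennreal (1 / G)) * (f x * g y)"
            by (simp only: ac_simps)
          ultimately show ?thesis by simp
        qed
        also have "\<dots> \<le> ennreal (1 / S) * ennreal (1 / S) * (h ((x + y) / 2))\<^sup>2"
          using h by (intro mult_left_mono) auto
        also have "\<dots> = (?h ((x + y) / 2))\<^sup>2" by (simp add: power2_eq_square ac_simps)
        finally show False by simp
      qed
    qed auto
    from ennreal_mult_le_square_if_add_le[OF this]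
    have le: "(\<integral>\<^sup>+x. ?f x \<partial>lborel) * (\<integral>\<^sup>+x. ?g x \<partial>lborel) \<le> (\<integral>\<^sup>+x. ?h x \<partial>lborel)\<^sup>2" .
    have "(\<integral>\<^sup>+x. f x \<partial>lborel) * (\<integral>\<^sup>+x. g x \<partial>lborel) = 
      (ennreal F * (\<integral>\<^sup>+x. ?f x \<partial>lborel)) * (ennreal G * (\<integral>\<^sup>+x. ?g x \<partial>lborel))"
      using pos by (simp add: nn_integral_cmult scale)
    also have "\<dots> = ennreal S * ennreal S * ((\<integral>\<^sup>+x. ?f x \<partial>lborel) * (\<integral>\<^sup>+x. ?g x \<partial>lborel))"
    proof -
      have "ennreal F * ennreal G = ennreal S * ennreal S"
        using pos S by (simp flip: ennreal_mult)
      moreover have "(ennreal F * a) * (ennreal G * b) = (ennreal F * ennreal G) * (a * b)" for a b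
        by (simp only: ac_simps)
      ultimately show ?thesis by simp
    qed
    also have "\<dots> \<le> ennreal S * ennreal S * (\<integral>\<^sup>+x. ?h x \<partial>lborel)\<^sup>2"
      using le by (intro mult_left_mono) auto
    also have "\<dots> = (ennreal S * (\<integral>\<^sup>+x. ?h x \<partial>lborel))\<^sup>2" by (simp add: power2_eq_square ac_simps)
    also have "\<dots> = (\<integral>\<^sup>+x. h x \<partial>lborel)\<^sup>2"
      using S by (simp add: nn_integral_cmult scale)
    finally show ?thesis .
  qed
qed


text \<open>
  Arbitrary functions are increasing limits of bounded functions with bounded support. The two
  truncation levels vary independently, so that each factor passes to its supremum separately.
\<close>

lemma Prekopa_Leindler_real:
  fixes f g h :: "real \<Rightarrow> ennreal"
  assumes [measurable]: "f \<in> borel_measurable borel" "g \<in> borel_measurable borel" "h \<in> borel_measurable borel"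
    and h: "\<And>x y. f x * g y \<le> (h ((x + y) / 2))\<^sup>2"
  shows "(\<integral>\<^sup>+x. f x \<partial>lborel) * (\<integral>\<^sup>+x. g x \<partial>lborel) \<le> (\<integral>\<^sup>+x. h x \<partial>lborel)\<^sup>2"
proof -
  define cut :: "(real \<Rightarrow> ennreal) \<Rightarrow> nat \<Rightarrow> real \<Rightarrow> ennreal" where
    "cut = (\<lambda>u n x. min (u x) (of_nat n) * indicator {- real n..real n} x)"
  have cut_le: "cut u n x \<le> u x" for u n x by (auto simp: cut_def indicator_def)
  have cut_meas [measurable]: "cut u n \<in> borel_measurable borel"
    if [measurable]: "u \<in> borel_measurable borel" for u n
    unfolding cut_def by measurable
  have cut_fin: "(SUP x. cut u n x) < top" for u n
  proof -
    have "(SUP x. cut u n x) \<le> of_nat n" by (intro SUP_least) (auto simp: cut_def indicator_def)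
    then show ?thesis using of_nat_less_top by (rule le_less_trans)
  qed
  have cut_bd: "bounded {x. cut u n x \<noteq> 0}" for u n
    by (rule bounded_subset[of "{- real n..real n}"]) (auto simp: cut_def indicator_def)
  have cut_SUP: "(\<integral>\<^sup>+x. u x \<partial>lborel) = (SUP n. \<integral>\<^sup>+x. cut u n x \<partial>lborel)"
    if [measurable]: "u \<in> borel_measurable borel" for u
  proof -
    have "(SUP n. cut u n x) = u x" for x
    proof (rule antisym)
      show "u x \<le> (SUP n. cut u n x)"
      proof (rule dense_le)
        fix z assume z: "z < u x"
        from z top_greatest have "z < top" by (rule less_le_trans)
        then obtain n1 where n1: "z \<le> of_nat n1"
          using ennreal_Ex_less_of_nat less_imp_le by blast
        obtain n2 where n2: "\<bar>x\<bar> \<le> real n2" using real_arch_simple by blast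
        define n where "n = max n1 n2"
        have "z \<le> of_nat n" using n1 by (rule order_trans) (simp add: n_def)
        moreover have "x \<in> {- real n..real n}" using n2 by (auto simp: n_def)
        ultimately have "z \<le> cut u n x" using z by (simp add: cut_def)
        then show "z \<le> (SUP n. cut u n x)" by (rule SUP_upper2[rotated]) simp
      qed
    qed (auto intro: SUP_least cut_le)
    then have "(\<integral>\<^sup>+x. u x \<partial>lborel) = (\<integral>\<^sup>+x. (SUP n. cut u n x) \<partial>lborel)" by simp
    also have "\<dots> = (SUP n. \<integral>\<^sup>+x. cut u n x \<partial>lborel)"
    proof (rule nn_integral_monotone_convergence_SUP)
      show "incseq (cut u)"
        by (auto simp: incseq_def le_fun_def cut_def indicator_def intro: min.coboundedI2)
    qed simp
    finally show ?thesis .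
  qed
  have "(\<integral>\<^sup>+x. cut f m x \<partial>lborel) * (\<integral>\<^sup>+x. cut g n x \<partial>lborel) \<le> (\<integral>\<^sup>+x. h x \<partial>lborel)\<^sup>2" for m n
    by (rule Prekopa_Leindler_real_bounded)
       (auto simp: cut_fin cut_bd intro: order_trans[OF mult_mono[OF cut_le cut_le] h])
  then show ?thesis
    by (simp add: cut_SUP[of f] cut_SUP[of g] SUP_mult_left_ennreal SUP_mult_right_ennreal SUP_least)
qed


abbreviation euclid :: "'i set \<Rightarrow> ('i \<Rightarrow> real) measure" where
  "euclid I \<equiv> Pi\<^sub>M I (\<lambda>_. lborel)"

text \<open>
  Fubini's theorem makes the inequality stable under products: integrating out one coordinate of
  \<open>f\<close>, \<open>g\<close> and \<open>h\<close> leaves functions that satisfy the hypothesis again, by the one-dimensional case.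
  Here \<open>f\<close> and \<open>g\<close> must be independent of each other: the sections of a single function at different
  points are different functions.
\<close>

lemma Prekopa_Leindler_euclid:
  fixes f g h :: "('i \<Rightarrow> real) \<Rightarrow> ennreal"
  assumes "finite I"
    and "f \<in> borel_measurable (euclid I)" "g \<in> borel_measurable (euclid I)"
      "h \<in> borel_measurable (euclid I)"
    and "\<And>x y. x \<in> extensional I \<Longrightarrow> y \<in> extensional I \<Longrightarrow>
      f x * g y \<le> (h (\<lambda>i\<in>I. (x i + y i) / 2))\<^sup>2"
  shows "(\<integral>\<^sup>+x. f x \<partial>euclid I) * (\<integral>\<^sup>+x. g x \<partial>euclid I)
    \<le> (\<integral>\<^sup>+x. h x \<partial>euclid I)\<^sup>2"
  using assms
proof (induction I arbitrary: f g h rule: finite_induct)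
  case empty
  interpret product_sigma_finite "\<lambda>_::'i. lborel :: real measure" ..
  show ?case using empty(4)[of "\<lambda>_. undefined" "\<lambda>_. undefined"]
    by (simp add: nn_integral_empty restrict_def)
next
  case (insert i I)
  interpret product_sigma_finite "\<lambda>_::'i. lborel :: real measure" ..
  note [measurable] = insert.prems(1-3)
  note [simp] = insert.hyps
  let ?int = "\<lambda>u x. \<integral>\<^sup>+t. u (x(i := t)) \<partial>lborel"
  have sec [measurable]: "(\<lambda>t. u (x(i := t))) \<in> borel_measurable borel"
    if [measurable]: "u \<in> borel_measurable (euclid (insert i I))" and "x \<in> extensional I" 
    for u :: "('i \<Rightarrow> real) \<Rightarrow> ennreal" and x
  proof -
    have [measurable]: "x \<in> space (euclid I)" using that by (simp add: space_PiM PiE_def)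
    show ?thesis by measurable
  qed
  have "(\<integral>\<^sup>+x. ?int f x \<partial>euclid I) * (\<integral>\<^sup>+x. ?int g x \<partial>euclid I)
    \<le> (\<integral>\<^sup>+x. ?int h x \<partial>euclid I)\<^sup>2"
  proof (rule insert.IH)
    fix x y :: "'i \<Rightarrow> real" assume xy: "x \<in> extensional I" "y \<in> extensional I"
    let ?m = "\<lambda>i\<in>I. (x i + y i) / 2"
    show "?int f x * ?int g y \<le> (?int h ?m)\<^sup>2"
    proof (rule Prekopa_Leindler_real)
      fix s t :: real
      have "f (x(i := s)) * g (y(i := t)) \<le>
        (h (\<lambda>j\<in>insert i I. ((x(i := s)) j + (y(i := t)) j) / 2))\<^sup>2"
        using xy by (intro insert.prems(4)) (auto simp: extensional_def)
      also have "(\<lambda>j\<in>insert i I. ((x(i := s)) j + (y(i := t)) j) / 2) = ?m(i := (s + t) / 2)"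
        by (auto simp: fun_eq_iff)
      finally show "f (x(i := s)) * g (y(i := t)) \<le> (h (?m(i := (s + t) / 2)))\<^sup>2" .
    next
      show "(\<lambda>t. f (x(i := t))) \<in> borel_measurable borel" "(\<lambda>t. g (y(i := t))) \<in> borel_measurable borel"
        using xy by (auto intro!: sec)
      show "(\<lambda>t. h (?m(i := t))) \<in> borel_measurable borel"
        by (rule sec) (auto simp: extensional_def)
    qed
  qed measurable
  then show ?case by (simp add: product_nn_integral_insert)
qed

section \<open>Volumes of ellipsoids and the isodiametric inequality\<close>

lemma space_euclid: "space (euclid I) = extensional I"
  by (simp add: space_PiM PiE_def)

lemma nn_integral_euclid_scale:
  assumes "finite I" "f \<in> borel_measurable (euclid I)" "\<And>i. i \<in> I \<Longrightarrow> c i \<noteq> 0"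
  shows "(\<integral>\<^sup>+x. f x \<partial>euclid I) =
    ennreal (\<Prod>i\<in>I. \<bar>c i\<bar>) * (\<integral>\<^sup>+x. f (\<lambda>i\<in>I. c i * x i) \<partial>euclid I)"
  using assms
proof (induction I arbitrary: f rule: finite_induct)
  case empty
  interpret product_sigma_finite "\<lambda>_::'a. lborel :: real measure" ..
  show ?case by (simp add: PiM_empty nn_integral_count_space_finite restrict_def)
next
  case (insert i I)
  interpret product_sigma_finite "\<lambda>_::'a. lborel :: real measure" ..
  note [measurable] = insert.prems(1)
  note [simp] = insert.hyps
  let ?s = "\<lambda>x. \<lambda>j\<in>I. c j * x j"
  have [measurable]: "(\<lambda>x. f (\<lambda>j\<in>insert i I. c j * x j)) \<in> borel_measurable (euclid (insert i I))"
    by measurable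
  have int: "(\<lambda>x. \<integral>\<^sup>+t. f (x(i := t)) \<partial>lborel) \<in> borel_measurable (euclid I)"
    by measurable
  have upd: "(\<lambda>j\<in>insert i I. c j * (x(i := t)) j) = (?s x)(i := c i * t)" for x t
    by (auto simp: fun_eq_iff)
  have "(\<integral>\<^sup>+x. f x \<partial>euclid (insert i I)) = (\<integral>\<^sup>+x. (\<integral>\<^sup>+t. f (x(i := t)) \<partial>lborel) \<partial>euclid I)"
    by (simp add: product_nn_integral_insert)
  also have "\<dots> = ennreal (\<Prod>i\<in>I. \<bar>c i\<bar>) * (\<integral>\<^sup>+x. (\<integral>\<^sup>+t. f ((?s x)(i := t)) \<partial>lborel) \<partial>euclid I)"
    using insert.prems(2) by (intro insert.IH int) blast
  also have "(\<integral>\<^sup>+x. (\<integral>\<^sup>+t. f ((?s x)(i := t)) \<partial>lborel) \<partial>euclid I) =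
    (\<integral>\<^sup>+x. \<bar>c i\<bar> * (\<integral>\<^sup>+t. f ((?s x)(i := c i * t)) \<partial>lborel) \<partial>euclid I)"
  proof (intro nn_integral_cong)
    fix x
    have [measurable]: "?s x \<in> space (euclid I)" by (simp add: space_euclid)
    have "(\<lambda>t. f ((?s x)(i := t))) \<in> borel_measurable borel" by measurable
    then show "(\<integral>\<^sup>+t. f ((?s x)(i := t)) \<partial>lborel) = \<bar>c i\<bar> * (\<integral>\<^sup>+t. f ((?s x)(i := c i * t)) \<partial>lborel)"
      using insert.prems(2)[of i] by (subst nn_integral_real_affine[where t=0 and c="c i"]) (simp_all del: fun_upd_apply)
  qed
  also have "\<dots> = \<bar>c i\<bar> * (\<integral>\<^sup>+x. (\<integral>\<^sup>+t. f ((?s x)(i := c i * t)) \<partial>lborel) \<partial>euclid I)"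
    by (intro nn_integral_cmult) measurable
  also have "(\<integral>\<^sup>+x. (\<integral>\<^sup>+t. f ((?s x)(i := c i * t)) \<partial>lborel) \<partial>euclid I) =
    (\<integral>\<^sup>+x. f (\<lambda>j\<in>insert i I. c j * x j) \<partial>euclid (insert i I))"
    by (simp add: product_nn_integral_insert upd del: fun_upd_apply)
  finally have "(\<integral>\<^sup>+x. f x \<partial>euclid (insert i I)) = ennreal (\<Prod>i\<in>I. \<bar>c i\<bar>) *
    (ennreal \<bar>c i\<bar> * (\<integral>\<^sup>+x. f (\<lambda>j\<in>insert i I. c j * x j) \<partial>euclid (insert i I)))" .
  moreover have "ennreal (\<Prod>i\<in>insert i I. \<bar>c i\<bar>) = ennreal (\<Prod>i\<in>I. \<bar>c i\<bar>) * ennreal \<bar>c i\<bar>"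
    by (simp add: ennreal_mult prod_nonneg mult.commute)
  ultimately show ?case by (simp only: mult.assoc)
qed

text \<open>
  The solid ellipsoid with semi-axes \<open>c\<close>; a constant \<open>c = (\<lambda>_. r)\<close> gives the closed Euclidean ball of
  radius \<open>r\<close>. Membership in \<open>extensional I\<close> places it in the space of the product measure.
\<close>

definition ellipsoid :: "'i set \<Rightarrow> ('i \<Rightarrow> real) \<Rightarrow> ('i \<Rightarrow> real) set" where
  "ellipsoid I c = {x \<in> extensional I. (\<Sum>i\<in>I. (x i / c i)\<^sup>2) \<le> 1}"

lemma ellipsoid_sets [measurable]: "ellipsoid I c \<in> sets (euclid I)"
  unfolding ellipsoid_def space_euclid[symmetric] by measurable

lemma emeasure_ellipsoid:
  assumes "finite I" and c: "\<And>i. i \<in> I \<Longrightarrow> c i > 0"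
  shows "emeasure (euclid I) (ellipsoid I c) =
    ennreal (\<Prod>i\<in>I. c i) * emeasure (euclid I) (ellipsoid I (\<lambda>_. 1))"
proof -
  have "emeasure (euclid I) (ellipsoid I c) = (\<integral>\<^sup>+x. indicator (ellipsoid I c) x \<partial>euclid I)"
    by simp
  also have "\<dots> = ennreal (\<Prod>i\<in>I. \<bar>c i\<bar>) *
      (\<integral>\<^sup>+x. indicator (ellipsoid I c) (\<lambda>i\<in>I. c i * x i) \<partial>euclid I)"
  proof (rule nn_integral_euclid_scale[OF assms(1)])
    show "c i \<noteq> 0" if "i \<in> I" for i using c[OF that] by simp
  qed measurable
  also have "(\<Prod>i\<in>I. \<bar>c i\<bar>) = (\<Prod>i\<in>I. c i)"
    using c by (intro prod.cong) (auto simp: less_imp_le)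
  also have "(\<integral>\<^sup>+x. indicator (ellipsoid I c) (\<lambda>i\<in>I. c i * x i) \<partial>euclid I) =
      (\<integral>\<^sup>+x. indicator (ellipsoid I (\<lambda>_. 1)) x \<partial>euclid I)"
  proof (intro nn_integral_cong)
    fix x assume "x \<in> space (euclid I)"
    moreover have "(\<Sum>i\<in>I. ((\<lambda>i\<in>I. c i * x i) i / c i)\<^sup>2) = (\<Sum>i\<in>I. (x i / 1)\<^sup>2)"
      using c by (intro sum.cong) (auto simp: less_imp_neq[symmetric])
    ultimately show "indicator (ellipsoid I c) (\<lambda>i\<in>I. c i * x i) = (indicator (ellipsoid I (\<lambda>_. 1)) x :: ennreal)"
      by (simp add: indicator_def ellipsoid_def space_euclid)
  qed
  finally show ?thesis by simp
qed

text \<open>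
  The unit ball lies between two cubes. Only these two facts about its volume matter, because the
  volume cancels from the covering estimate.
\<close>

lemma emeasure_unit_ball_pos_finite:
  assumes I: "finite I"
  shows "emeasure (euclid I) (ellipsoid I (\<lambda>_. 1)) > 0"
    and "emeasure (euclid I) (ellipsoid I (\<lambda>_. 1)) < top"
proof -
  interpret product_sigma_finite "\<lambda>_::'a. lborel :: real measure" ..
  define m where "m = real (card I) + 1"
  have m: "m > 0" by (simp add: m_def)
  have "0 < (\<Prod>i\<in>I. ennreal (2 / m))"
    using I m by (simp add: prod_pos ennreal_power zero_less_iff_neq_zero)
  also have "\<dots> = (\<Prod>i\<in>I. emeasure lborel {- 1 / m..1 / m})"
    using m by (intro prod.cong) (auto simp: emeasure_lborel_Icc_eq field_simps)
  also have "\<dots> = emeasure (euclid I) (Pi\<^sub>E I (\<lambda>_. {- 1 / m..1 / m}))"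
    using I by (simp add: emeasure_PiM)
  also have "\<dots> \<le> emeasure (euclid I) (ellipsoid I (\<lambda>_. 1))"
  proof (rule emeasure_mono)
    show "Pi\<^sub>E I (\<lambda>_. {- 1 / m..1 / m}) \<subseteq> ellipsoid I (\<lambda>_. 1)"
    proof
      fix x assume x: "x \<in> Pi\<^sub>E I (\<lambda>_. {- 1 / m..1 / m})"
      have "(x i)\<^sup>2 \<le> 1 / m" if "i \<in> I" for i
      proof -
        have "x i \<in> {- 1 / m..1 / m}" using x that by (auto simp: PiE_def Pi_def)
        then have "\<bar>x i\<bar> \<le> 1 / m" by auto
        then have "(x i)\<^sup>2 \<le> (1 / m)\<^sup>2" by (metis abs_ge_zero power2_abs power_mono)
        also have "\<dots> \<le> 1 / m"
          unfolding power2_eq_square using m by (intro mult_left_le) (auto simp: m_def)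
        finally show ?thesis .
      qed
      then have "(\<Sum>i\<in>I. (x i)\<^sup>2) \<le> (\<Sum>i\<in>I. 1 / m)" by (intro sum_mono) auto
      also have "\<dots> \<le> 1" using m by (simp add: m_def)
      finally show "x \<in> ellipsoid I (\<lambda>_. 1)" using x by (simp add: ellipsoid_def PiE_def)
    qed
  qed measurable
  finally show "emeasure (euclid I) (ellipsoid I (\<lambda>_. 1)) > 0" .
  have "emeasure (euclid I) (ellipsoid I (\<lambda>_. 1)) \<le> emeasure (euclid I) (Pi\<^sub>E I (\<lambda>_. {-1..1}))"
  proof (rule emeasure_mono)
    show "ellipsoid I (\<lambda>_. 1) \<subseteq> Pi\<^sub>E I (\<lambda>_. {-1..1::real})"
    proof
      fix x :: "'a \<Rightarrow> real" assume x: "x \<in> ellipsoid I (\<lambda>_. 1)"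
      have "x i \<in> {-1..1}" if "i \<in> I" for i
      proof -
        have "(x i)\<^sup>2 \<le> (\<Sum>i\<in>I. (x i)\<^sup>2)" using I that by (intro member_le_sum) auto
        also have "\<dots> \<le> 1" using x by (simp add: ellipsoid_def)
        finally have "\<bar>x i\<bar> \<le> 1" by (simp add: abs_square_le_1)
        then show ?thesis by auto
      qed
      then show "x \<in> Pi\<^sub>E I (\<lambda>_. {-1..1})" using x by (simp add: ellipsoid_def PiE_def)
    qed
    show "Pi\<^sub>E I (\<lambda>_. {-1..1}) \<in> sets (euclid I)" using I by (intro sets_PiM_I_finite) auto
  qed
  also have "\<dots> = (\<Prod>i\<in>I. emeasure lborel {-1..1::real})"
    using I by (intro emeasure_PiM) auto
  also have "\<dots> < top"
    by (simp add: emeasure_lborel_Icc_eq ennreal_power power_less_top_ennreal)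
  finally show "emeasure (euclid I) (ellipsoid I (\<lambda>_. 1)) < top" .
qed

text \<open>
  If \<open>A\<close> has diameter at most \<open>2 r\<close>, the midpoint of a point of \<open>A\<close> and a point of \<open>- A\<close> has norm at
  most \<open>r\<close>. The Prekopa-Leindler inequality for the indicator functions of \<open>A\<close>, \<open>- A\<close> and the ball of
  radius \<open>r\<close> then says that \<open>vol A * vol (- A) \<le> (vol ball)\<^sup>2\<close>, and \<open>A\<close> and \<open>- A\<close> have equal volume.
\<close>

theorem isodiametric_inequality:
  fixes A :: "('i \<Rightarrow> real) set"
  assumes I: "finite I" and A [measurable]: "A \<in> sets (euclid I)" and r: "r > 0"
    and diam: "\<And>x y. x \<in> A \<Longrightarrow> y \<in> A \<Longrightarrow> (\<Sum>i\<in>I. (x i - y i)\<^sup>2) \<le> (2 * r)\<^sup>2"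
  shows "emeasure (euclid I) A \<le> emeasure (euclid I) (ellipsoid I (\<lambda>_. r))"
proof -
  let ?B = "ellipsoid I (\<lambda>_. r)"
  have "(\<integral>\<^sup>+x. indicator A x \<partial>euclid I) * (\<integral>\<^sup>+y. indicator A (\<lambda>i\<in>I. - 1 * y i) \<partial>euclid I)
      \<le> (\<integral>\<^sup>+z. indicator ?B z \<partial>euclid I)\<^sup>2"
  proof (rule Prekopa_Leindler_euclid[OF I])
    fix x y :: "'i \<Rightarrow> real" assume "x \<in> extensional I" "y \<in> extensional I"
    let ?z = "\<lambda>i\<in>I. (x i + y i) / 2" and ?y = "\<lambda>i\<in>I. - 1 * y i"
    have "?z \<in> ?B" if "x \<in> A" "?y \<in> A"
    proof -
      have "(\<Sum>i\<in>I. (?z i / r)\<^sup>2) = (\<Sum>i\<in>I. (x i - ?y i)\<^sup>2) / (2 * r)\<^sup>2"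
        using r by (simp add: sum_divide_distrib power_divide power_mult_distrib)
      also have "\<dots> \<le> 1" using diam[OF that] r by simp
      finally show ?thesis by (simp add: ellipsoid_def)
    qed
    then show "indicator A x * indicator A ?y \<le> (indicator ?B ?z :: ennreal)\<^sup>2"
      by (auto simp: indicator_def)
  qed measurable
  also have "(\<integral>\<^sup>+y. indicator A (\<lambda>i\<in>I. - 1 * y i) \<partial>euclid I) = (\<integral>\<^sup>+x. indicator A x \<partial>euclid I)"
    using nn_integral_euclid_scale[OF I, of "indicator A" "\<lambda>_. - 1"] by simp
  finally have "emeasure (euclid I) A * emeasure (euclid I) A \<le> emeasure (euclid I) ?B * emeasure (euclid I) ?B"
    by (simp add: power2_eq_square)
  then show ?thesis
    using ennreal_square_less_mult[of "emeasure (euclid I) ?B" "emeasure (euclid I) A"] by (meson not_less)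
qed

text \<open>
  The projections of covering sets need not be measurable. Let the polar of \<open>S\<close> consist of the
  points at squared distance at most \<open>D\<close> from every point of \<open>S\<close>. A polar is closed, hence Borel.
  Since \<open>A\<close> is contained in its polar, the polar of the polar contains \<open>A\<close> and is contained in
  the polar of \<open>A\<close>; the latter says that the diameter has not grown.
\<close>

lemma measurable_hull_same_diameter:
  fixes A :: "('i::countable \<Rightarrow> real) set"
  assumes A: "A \<subseteq> extensional I"
    and diam: "\<And>x y. x \<in> A \<Longrightarrow> y \<in> A \<Longrightarrow> (\<Sum>i\<in>I. (x i - y i)\<^sup>2) \<le> D"
  obtains B where "B \<in> sets (euclid I)" "A \<subseteq> B"
    "\<And>x y. x \<in> B \<Longrightarrow> y \<in> B \<Longrightarrow> (\<Sum>i\<in>I. (x i - y i)\<^sup>2) \<le> D"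
proof -
  define polar where "polar S = (\<Inter>y\<in>S. {x::'i \<Rightarrow> real. (\<Sum>i\<in>I. (x i - y i)\<^sup>2) \<le> D})" for S
  have closed: "closed (polar S)" for S
    unfolding polar_def
    by (intro closed_INT ballI closed_Collect_le continuous_intros continuous_on_product_coordinates)
  define B where "B = polar (polar A) \<inter> space (euclid I)"
  have "A \<subseteq> polar A" using diam by (auto simp: polar_def)
  moreover have "A \<subseteq> polar (polar A)"
  proof
    fix x assume "x \<in> A"
    have "(\<Sum>i\<in>I. (x i - y i)\<^sup>2) \<le> D" if "y \<in> polar A" for y
      using that \<open>x \<in> A\<close> by (auto simp: polar_def power2_commute[of "x i" "y i" for i])
    then show "x \<in> polar (polar A)" by (auto simp: polar_def[of "polar A"])
  qed
  moreover have "polar (polar A) \<subseteq> polar A"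
    using \<open>A \<subseteq> polar A\<close> by (auto simp: polar_def)
  ultimately have "A \<subseteq> B" and B: "B \<subseteq> polar (polar A)" "B \<subseteq> polar A"
    using A by (auto simp: B_def space_euclid)
  have diamB: "(\<Sum>i\<in>I. (x i - y i)\<^sup>2) \<le> D" if "x \<in> B" "y \<in> B" for x y
  proof -
    have "x \<in> polar (polar A)" "y \<in> polar A" using that B by auto
    then show ?thesis unfolding polar_def[of "polar A"] by blast
  qed
  have "(\<lambda>x. x) \<in> measurable (euclid I) (Pi\<^sub>M UNIV (\<lambda>_. borel))"
  proof (rule measurable_PiM_single')
    fix i :: 'i
    show "(\<lambda>x. x i) \<in> borel_measurable (euclid I)"
    proof (cases "i \<in> I")
      case False
      then have "(\<lambda>x. x i) \<in> borel_measurable (euclid I) \<longleftrightarrow> (\<lambda>_. undefined :: real) \<in> borel_measurable (euclid I)"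
        by (intro measurable_cong) (auto simp: space_euclid extensional_def)
      then show ?thesis by simp
    qed measurable
  qed auto
  moreover have "polar (polar A) \<in> sets (Pi\<^sub>M UNIV (\<lambda>_. borel))"
    unfolding sets_PiM_equal_borel using closed by (rule borel_closed)
  ultimately have "B \<in> sets (euclid I)"
    unfolding B_def using measurable_sets[of "\<lambda>x. x" "euclid I" _ "polar (polar A)"] by (simp add: vimage_def)
  then show thesis using that \<open>A \<subseteq> B\<close> diamB by blast
qed


text \<open>
  Comparison of volumes: each covering set has at most the volume of a ball of radius \<open>r\<close>, while the
  ellipsoid has the volume of the unit ball times the product of its semi-axes.
\<close>

theorem ellipsoid_cover_bound:
  fixes A :: "'k \<Rightarrow> ('i::countable \<Rightarrow> real) set"
  assumes I: "finite I" and c: "\<And>i. i \<in> I \<Longrightarrow> c i > 0" and r: "r > 0" and K: "finite K"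
    and cover: "ellipsoid I c \<subseteq> (\<Union>k\<in>K. A k)"
    and ext: "\<And>k. k \<in> K \<Longrightarrow> A k \<subseteq> extensional I"
    and diam: "\<And>k x y. k \<in> K \<Longrightarrow> x \<in> A k \<Longrightarrow> y \<in> A k \<Longrightarrow> (\<Sum>i\<in>I. (x i - y i)\<^sup>2) \<le> (2 * r)\<^sup>2"
  shows "(\<Prod>i\<in>I. c i) \<le> real (card K) * r ^ card I"
proof -
  let ?v = "emeasure (euclid I) (ellipsoid I (\<lambda>_. 1))"
  have "\<forall>k\<in>K. \<exists>B. B \<in> sets (euclid I) \<and> A k \<subseteq> B \<and>
      (\<forall>x\<in>B. \<forall>y\<in>B. (\<Sum>i\<in>I. (x i - y i)\<^sup>2) \<le> (2 * r)\<^sup>2)"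
  proof
    fix k assume k: "k \<in> K"
    show "\<exists>B. B \<in> sets (euclid I) \<and> A k \<subseteq> B \<and>
      (\<forall>x\<in>B. \<forall>y\<in>B. (\<Sum>i\<in>I. (x i - y i)\<^sup>2) \<le> (2 * r)\<^sup>2)"
    proof (rule measurable_hull_same_diameter[OF ext[OF k] diam[OF k]])
      fix B assume "B \<in> sets (euclid I)" "A k \<subseteq> B"
        "\<And>x y. x \<in> B \<Longrightarrow> y \<in> B \<Longrightarrow> (\<Sum>i\<in>I. (x i - y i)\<^sup>2) \<le> (2 * r)\<^sup>2"
      then show ?thesis by blast
    qed
  qed
  from bchoice[OF this] obtain B where "\<forall>k\<in>K. B k \<in> sets (euclid I) \<and> A k \<subseteq> B k \<and>
      (\<forall>x\<in>B k. \<forall>y\<in>B k. (\<Sum>i\<in>I. (x i - y i)\<^sup>2) \<le> (2 * r)\<^sup>2)" by blast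
  then have B: "\<And>k. k \<in> K \<Longrightarrow> B k \<in> sets (euclid I)" "\<And>k. k \<in> K \<Longrightarrow> A k \<subseteq> B k"
      "\<And>k x y. k \<in> K \<Longrightarrow> x \<in> B k \<Longrightarrow> y \<in> B k \<Longrightarrow> (\<Sum>i\<in>I. (x i - y i)\<^sup>2) \<le> (2 * r)\<^sup>2"
    by blast+
  have "ennreal (\<Prod>i\<in>I. c i) * ?v = emeasure (euclid I) (ellipsoid I c)"
    using emeasure_ellipsoid[OF I c] by simp
  also have "\<dots> \<le> emeasure (euclid I) (\<Union>k\<in>K. B k)"
  proof (rule emeasure_mono)
    have "(\<Union>k\<in>K. A k) \<subseteq> (\<Union>k\<in>K. B k)" using B(2) by (rule UN_mono[OF order_refl])
    with cover show "ellipsoid I c \<subseteq> (\<Union>k\<in>K. B k)" by (rule order_trans)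
    show "(\<Union>k\<in>K. B k) \<in> sets (euclid I)" using B(1) K by (intro sets.finite_UN)
  qed
  also have "\<dots> \<le> (\<Sum>k\<in>K. emeasure (euclid I) (B k))"
    using K B(1) by (intro emeasure_subadditive_finite) auto
  also have "\<dots> \<le> (\<Sum>k\<in>K. emeasure (euclid I) (ellipsoid I (\<lambda>_. r)))"
  proof (rule sum_mono)
    fix k assume "k \<in> K"
    show "emeasure (euclid I) (B k) \<le> emeasure (euclid I) (ellipsoid I (\<lambda>_. r))"
      by (rule isodiametric_inequality[OF I B(1)[OF \<open>k \<in> K\<close>] r B(3)[OF \<open>k \<in> K\<close>]])
  qed
  also have "\<dots> = ennreal (real (card K) * r ^ card I) * ?v"
    using emeasure_ellipsoid[OF I, of "\<lambda>_. r"] r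
    by (simp add: ennreal_mult ennreal_of_nat_eq_real_of_nat mult.assoc)
  finally have le: "ennreal (\<Prod>i\<in>I. c i) * ?v \<le> ennreal (real (card K) * r ^ card I) * ?v" .
  obtain v where v: "?v = ennreal v" "v > 0"
    using emeasure_unit_ball_pos_finite[OF I] by (cases ?v) auto
  have "(\<Prod>i\<in>I. c i) * v \<le> real (card K) * r ^ card I * v"
    using le v r c unfolding v
    by (simp add: prod_nonneg less_imp_le flip: ennreal_mult)
  then show ?thesis using v by simp
qed

section \<open>Geometry of the space of square-integrable functions\<close>

lemma L2_borel_measurable [measurable_dest]: "f \<in> L2 a b \<Longrightarrow> f \<in> borel_measurable (lebesgue_on {a..b})"
  by (simp add: L2_def)

lemma L2_mult_integrable:
  assumes "f \<in> L2 a b" "g \<in> L2 a b"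
  shows "integrable (lebesgue_on {a..b}) (\<lambda>x. f x * g x)"
proof (rule Bochner_Integration.integrable_bound)
  show "integrable (lebesgue_on {a..b}) (\<lambda>x. (f x)\<^sup>2 + (g x)\<^sup>2)"
    using assms by (simp add: L2_def)
  show "(\<lambda>x. f x * g x) \<in> borel_measurable (lebesgue_on {a..b})"
    using assms by (intro borel_measurable_times L2_borel_measurable)
  show "AE x in lebesgue_on {a..b}. norm (f x * g x) \<le> norm ((f x)\<^sup>2 + (g x)\<^sup>2)"
  proof (intro AE_I2)
    fix x
    have "2 * (\<bar>f x\<bar> * \<bar>g x\<bar>) \<le> (f x)\<^sup>2 + (g x)\<^sup>2"
      using sum_squares_bound[of "\<bar>f x\<bar>" "\<bar>g x\<bar>"] by (simp add: mult.assoc)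
    moreover have "0 \<le> \<bar>f x\<bar> * \<bar>g x\<bar>" by simp
    ultimately show "norm (f x * g x) \<le> norm ((f x)\<^sup>2 + (g x)\<^sup>2)"
      unfolding real_norm_def abs_mult by linarith
  qed
qed

lemma L2_add: "f \<in> L2 a b \<Longrightarrow> g \<in> L2 a b \<Longrightarrow> (\<lambda>x. f x + g x) \<in> L2 a b"
  using L2_mult_integrable[of f a b g]
  by (auto simp: L2_def power2_sum mult.assoc intro: borel_measurable_add)

lemma L2_scale: "f \<in> L2 a b \<Longrightarrow> (\<lambda>x. c * f x) \<in> L2 a b"
  by (auto simp: L2_def power_mult_distrib intro: borel_measurable_times)

lemma L2_diff: "f \<in> L2 a b \<Longrightarrow> g \<in> L2 a b \<Longrightarrow> (\<lambda>x. f x - g x) \<in> L2 a b"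
  using L2_add[of f a b "\<lambda>x. - 1 * g x"] L2_scale[of g a b "- 1"] by simp

lemma L2_zero: "(\<lambda>x. 0) \<in> L2 a b"
  by (simp add: L2_def)

lemma L2_lincomb:
  assumes "finite I" "\<And>k. k \<in> I \<Longrightarrow> \<psi> k \<in> L2 a b"
  shows "(\<lambda>x. \<Sum>k\<in>I. c k * \<psi> k x) \<in> L2 a b"
  using assms
proof (induction I rule: finite_induct)
  case empty
  then show ?case by (simp add: L2_zero)
next
  case (insert i I)
  then have "(\<lambda>x. c i * \<psi> i x + (\<Sum>k\<in>I. c k * \<psi> k x)) \<in> L2 a b"
    by (intro L2_add L2_scale insert.IH) auto
  with insert.hyps show ?case by simp
qed

lemma l2_inner_commute: "l2_inner a b f g = l2_inner a b g f"
  by (simp add: l2_inner_def mult.commute)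

lemma l2_inner_diff_left:
  assumes "f \<in> L2 a b" "g \<in> L2 a b" "h \<in> L2 a b"
  shows "l2_inner a b (\<lambda>x. f x - g x) h = l2_inner a b f h - l2_inner a b g h"
  using assms by (simp add: l2_inner_def left_diff_distrib L2_mult_integrable)

lemma l2_inner_scale_right: "l2_inner a b f (\<lambda>x. c * g x) = c * l2_inner a b f g"
  by (simp add: l2_inner_def mult.left_commute[of _ c])

lemma l2_inner_lincomb_left:
  assumes "finite I" "\<And>k. k \<in> I \<Longrightarrow> \<psi> k \<in> L2 a b" "h \<in> L2 a b"
  shows "l2_inner a b (\<lambda>x. \<Sum>k\<in>I. c k * \<psi> k x) h = (\<Sum>k\<in>I. c k * l2_inner a b (\<psi> k) h)"
  using assms unfolding l2_inner_def sum_distrib_right mult.assoc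
  by (subst Bochner_Integration.integral_sum) (auto intro!: L2_mult_integrable)

lemma l2_inner_self_nonneg: "0 \<le> l2_inner a b f f"
  unfolding l2_inner_def by (intro integral_nonneg_AE) auto

lemma l2_norm_squared: "(l2_norm a b f)\<^sup>2 = l2_inner a b f f"
  by (simp add: l2_norm_def l2_inner_self_nonneg)

lemma l2_dist_nonneg: "0 \<le> l2_dist a b f g"
  by (simp add: l2_dist_def l2_norm_def l2_inner_self_nonneg)

lemma l2_dist_commute: "l2_dist a b f g = l2_dist a b g f"
proof -
  have "(f x - g x) * (f x - g x) = (g x - f x) * (g x - f x)" for x by (simp add: algebra_simps)
  then show ?thesis unfolding l2_dist_def l2_norm_def l2_inner_def by simp
qed

text \<open>
  This consequence of the parallelogram law replaces the triangle inequality below; it is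
  equally sharp for two vectors of the same norm bound \<open>r\<close>, where both give \<open>(2 * r)\<^sup>2\<close>.
\<close>

lemma l2_inner_diff_self_le:
  assumes "f \<in> L2 a b" "g \<in> L2 a b"
  shows "l2_inner a b (\<lambda>x. f x - g x) (\<lambda>x. f x - g x) \<le> 2 * l2_inner a b f f + 2 * l2_inner a b g g"
proof -
  have "l2_inner a b (\<lambda>x. f x - g x) (\<lambda>x. f x - g x) \<le>
    (\<integral>x. 2 * (f x * f x) + 2 * (g x * g x) \<partial>lebesgue_on {a..b})"
    unfolding l2_inner_def
  proof (rule integral_mono)
    show "integrable (lebesgue_on {a..b}) (\<lambda>x. (f x - g x) * (f x - g x))"
      by (intro L2_mult_integrable L2_diff assms)
    show "integrable (lebesgue_on {a..b}) (\<lambda>x. 2 * (f x * f x) + 2 * (g x * g x))"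
      using assms by (simp add: L2_mult_integrable)
    fix x
    show "(f x - g x) * (f x - g x) \<le> 2 * (f x * f x) + 2 * (g x * g x)"
      using zero_le_square[of "f x + g x"] by (simp add: algebra_simps)
  qed
  also have "\<dots> = 2 * l2_inner a b f f + 2 * l2_inner a b g g"
    using assms by (simp add: l2_inner_def L2_mult_integrable)
  finally show ?thesis .
qed

lemma l2_inner_cong:
  assumes "f \<in> L2 a b" "f' \<in> L2 a b" "g \<in> L2 a b" "l2_eq a b f f'"
  shows "l2_inner a b g f = l2_inner a b g f'"
  unfolding l2_inner_def
  by (rule integral_cong_AE) (use assms in \<open>auto simp: L2_def l2_eq_def\<close>)

lemma l2_diameter_le_iff:
  assumes "D \<ge> 0"
  shows "l2_diameter a b S \<le> ennreal D \<longleftrightarrow> (\<forall>f\<in>S. \<forall>g\<in>S. l2_dist a b f g \<le> D)"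
  using assms by (simp add: l2_diameter_def SUP_le_iff)

lemma l2_inner_residual:
  assumes I: "finite I" and f: "f \<in> L2 a b" and \<psi>: "\<And>k. k \<in> I \<Longrightarrow> \<psi> k \<in> L2 a b"
    and on: "\<And>j k. j \<in> I \<Longrightarrow> k \<in> I \<Longrightarrow> l2_inner a b (\<psi> j) (\<psi> k) = (if j = k then 1 else 0)"
    and r: "r = (\<lambda>x. f x - (\<Sum>k\<in>I. l2_inner a b f (\<psi> k) * \<psi> k x))"
  shows "l2_inner a b r r = l2_inner a b f f - (\<Sum>k\<in>I. (l2_inner a b f (\<psi> k))\<^sup>2)"
proof -
  define S where "S = (\<lambda>x. \<Sum>k\<in>I. l2_inner a b f (\<psi> k) * \<psi> k x)"
  have S: "S \<in> L2 a b" unfolding S_def using I \<psi> by (rule L2_lincomb)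
  have r: "r = (\<lambda>x. f x - S x)" and rL2: "r \<in> L2 a b"
    using L2_diff[OF f S] by (auto simp: r S_def)
  have Sh: "l2_inner a b S h = (\<Sum>k\<in>I. l2_inner a b f (\<psi> k) * l2_inner a b (\<psi> k) h)"
    if "h \<in> L2 a b" for h
    unfolding S_def using I \<psi> that by (rule l2_inner_lincomb_left)
  have Sf: "l2_inner a b S f = (\<Sum>k\<in>I. (l2_inner a b f (\<psi> k))\<^sup>2)"
    unfolding Sh[OF f] power2_eq_square by (simp add: l2_inner_commute)
  have "l2_inner a b S (\<psi> k) = l2_inner a b f (\<psi> k)" if "k \<in> I" for k
  proof -
    have "l2_inner a b S (\<psi> k) = (\<Sum>j\<in>I. l2_inner a b f (\<psi> j) * (if j = k then 1 else 0))"
      unfolding Sh[OF \<psi>[OF that]] using on that by (intro sum.cong) auto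
    also have "\<dots> = l2_inner a b f (\<psi> k)" using I that by (simp add: if_distrib sum.delta cong: if_cong)
    finally show ?thesis .
  qed
  then have SS: "l2_inner a b S S = (\<Sum>k\<in>I. (l2_inner a b f (\<psi> k))\<^sup>2)"
    unfolding Sh[OF S] power2_eq_square by (simp add: l2_inner_commute[of a b "\<psi> _" S])
  have "l2_inner a b r r = l2_inner a b f r - l2_inner a b S r"
    using l2_inner_diff_left[OF f S rL2] by (simp add: r)
  also have "l2_inner a b f r = l2_inner a b f f - l2_inner a b S f"
    unfolding l2_inner_commute[of a b f r] using l2_inner_diff_left[OF f S f] by (simp add: r)
  also have "l2_inner a b S r = l2_inner a b f S - l2_inner a b S S"
    unfolding l2_inner_commute[of a b S r] using l2_inner_diff_left[OF f S S] by (simp add: r)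
  finally show ?thesis using Sf SS by (simp add: l2_inner_commute[of a b f S])
qed

lemma Bessel_inequality:
  assumes "finite I" "f \<in> L2 a b" "\<And>k. k \<in> I \<Longrightarrow> \<psi> k \<in> L2 a b"
    and "\<And>j k. j \<in> I \<Longrightarrow> k \<in> I \<Longrightarrow> l2_inner a b (\<psi> j) (\<psi> k) = (if j = k then 1 else 0)"
  shows "(\<Sum>k\<in>I. (l2_inner a b f (\<psi> k))\<^sup>2) \<le> l2_inner a b f f"
proof -
  let ?r = "\<lambda>x. f x - (\<Sum>k\<in>I. l2_inner a b f (\<psi> k) * \<psi> k x)"
  have "0 \<le> l2_inner a b ?r ?r" by (rule l2_inner_self_nonneg)
  also have "\<dots> = l2_inner a b f f - (\<Sum>k\<in>I. (l2_inner a b f (\<psi> k))\<^sup>2)"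
    by (rule l2_inner_residual[OF assms refl])
  finally show ?thesis by simp
qed

lemma Parseval_limit:
  assumes basis: "l2_orthonormal_basis a b \<psi>" and f: "f \<in> L2 a b"
  shows "(\<lambda>n. \<Sum>k=1..n. (l2_inner a b f (\<psi> k))\<^sup>2) \<longlonglongrightarrow> l2_inner a b f f"
proof -
  let ?r = "\<lambda>n x. f x - (\<Sum>k=1..n. l2_inner a b f (\<psi> k) * \<psi> k x)"
  have eq: "(\<Sum>k=1..n. (l2_inner a b f (\<psi> k))\<^sup>2) =
      l2_inner a b f f - (l2_dist a b f (\<lambda>x. \<Sum>k=1..n. l2_inner a b f (\<psi> k) * \<psi> k x))\<^sup>2" for n
    using basis l2_inner_residual[of "{1..n}" f a b \<psi> "?r n"] f
    by (simp add: l2_orthonormal_basis_def l2_dist_def l2_norm_squared)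
  have "(\<lambda>n. l2_dist a b f (\<lambda>x. \<Sum>k=1..n. l2_inner a b f (\<psi> k) * \<psi> k x)) \<longlonglongrightarrow> 0"
    using basis f by (simp add: l2_orthonormal_basis_def)
  then have "(\<lambda>n. l2_inner a b f f - (l2_dist a b f (\<lambda>x. \<Sum>k=1..n. l2_inner a b f (\<psi> k) * \<psi> k x))\<^sup>2)
      \<longlonglongrightarrow> l2_inner a b f f - 0\<^sup>2"
    by (intro tendsto_intros)
  then show ?thesis unfolding eq by simp
qed

section \<open>Covering and packing numbers\<close>

text \<open>
  A set of diameter at most \<open>\<epsilon>\<close> contains at most one of the points.
\<close>

lemma distinguishable_le_covering:
  assumes y: "eps_distinguishable a b \<epsilon> E m y" and Y: "eps_covering a b (\<epsilon> / 2) E n Y" and "\<epsilon> > 0"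
  shows "m \<le> n"
proof -
  have "\<exists>k\<in>{1..n}. y i \<in> Y k" if "i \<in> {1..m}" for i
    using y Y that unfolding eps_distinguishable_def eps_covering_def by blast
  then obtain h where h: "\<And>i. i \<in> {1..m} \<Longrightarrow> h i \<in> {1..n} \<and> y i \<in> Y (h i)" by metis
  have "inj_on h {1..m}"
  proof (rule inj_onI, rule ccontr)
    fix i j assume ij: "i \<in> {1..m}" "j \<in> {1..m}" "h i = h j" "i \<noteq> j"
    have "l2_diameter a b (Y (h i)) \<le> ennreal \<epsilon>"
      using Y h[OF ij(1)] by (simp add: eps_covering_def)
    then have "l2_dist a b (y i) (y j) \<le> \<epsilon>"
      using h[OF ij(1)] h[OF ij(2)] ij(3) \<open>\<epsilon> > 0\<close> by (simp add: l2_diameter_le_iff)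
    moreover have "l2_dist a b (y i) (y j) > \<epsilon>"
      using y ij by (simp add: eps_distinguishable_def)
    ultimately show False by simp
  qed
  then have "card {1..m} \<le> card {1..n}" using h by (intro card_inj_on_le[of h]) auto
  then show ?thesis by simp
qed

text \<open>
  A point at distance more than \<open>\<epsilon>\<close> from all the \<open>y k\<close> could be added to them, so the
  \<open>\<epsilon>\<close>-balls around the \<open>y k\<close> cover \<open>E\<close>.
\<close>

lemma maximal_distinguishable_covering:
  assumes y: "eps_distinguishable a b \<epsilon> E m y" and max: "\<And>z. \<not> eps_distinguishable a b \<epsilon> E (Suc m) z"
    and E: "E \<subseteq> L2 a b" and \<epsilon>: "\<epsilon> > 0"
  shows "eps_covering a b \<epsilon> E m (\<lambda>k. {g \<in> E. l2_dist a b g (y k) \<le> \<epsilon>})"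
  unfolding eps_covering_def
proof (intro conjI ballI subsetI)
  fix k assume k: "k \<in> {1..m}"
  have yk: "y k \<in> L2 a b" using y k E by (auto simp: eps_distinguishable_def)
  have "l2_dist a b f g \<le> 2 * \<epsilon>" if "f \<in> E" "l2_dist a b f (y k) \<le> \<epsilon>" "g \<in> E" "l2_dist a b g (y k) \<le> \<epsilon>" for f g
  proof -
    have "f \<in> L2 a b" "g \<in> L2 a b" using that E by auto
    then have "(l2_dist a b f g)\<^sup>2 \<le> 2 * (l2_dist a b f (y k))\<^sup>2 + 2 * (l2_dist a b g (y k))\<^sup>2"
      using l2_inner_diff_self_le[OF L2_diff[OF _ yk] L2_diff[OF _ yk], of f g]
      by (simp add: l2_dist_def l2_norm_squared)
    also have "\<dots> \<le> 2 * \<epsilon>\<^sup>2 + 2 * \<epsilon>\<^sup>2"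
      using that by (intro add_mono mult_left_mono power_mono l2_dist_nonneg) auto
    also have "\<dots> = (2 * \<epsilon>)\<^sup>2" by (simp add: power2_eq_square)
    finally show ?thesis by (rule power2_le_imp_le) (use \<epsilon> in simp)
  qed
  then show "l2_diameter a b {g \<in> E. l2_dist a b g (y k) \<le> \<epsilon>} \<le> ennreal (2 * \<epsilon>)"
    using \<epsilon> by (subst l2_diameter_le_iff) auto
next
  fix g assume g: "g \<in> E"
  show "g \<in> (\<Union>k\<in>{1..m}. {g \<in> E. l2_dist a b g (y k) \<le> \<epsilon>})"
  proof (rule ccontr)
    assume "\<not> ?thesis"
    then have far: "l2_dist a b g (y k) > \<epsilon>" "l2_dist a b (y k) g > \<epsilon>" if "k \<in> {1..m}" for k
      using g that by (auto simp: not_le l2_dist_commute[of a b "y k" g])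
    have "eps_distinguishable a b \<epsilon> E (Suc m) (y(Suc m := g))"
      using y far g unfolding eps_distinguishable_def
      by (auto simp: atLeastAtMostSuc_conv)
    with max show False by blast
  qed
qed (use E in auto)

text \<open>
  The finite \<open>\<epsilon> / 2\<close>-covering guarantees that the minima and the maximum behind the covering and
  packing numbers are attained.
\<close>

lemma covering_packing_sandwich:
  assumes E: "E \<subseteq> L2 a b" and \<epsilon>: "\<epsilon> > 0" and fin: "eps_covering a b (\<epsilon> / 2) E n Y"
  shows "covering_number a b \<epsilon> E \<le> packing_number a b \<epsilon> E"
    and "packing_number a b \<epsilon> E \<le> covering_number a b (\<epsilon> / 2) E"
    and "covering_number a b (\<epsilon> / 2) E \<le> n"
    and "\<exists>Y. eps_covering a b \<epsilon> E (covering_number a b \<epsilon> E) Y"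
proof -
  let ?P = "\<lambda>m. \<exists>y. eps_distinguishable a b \<epsilon> E m y"
  have bound: "m \<le> n" if "?P m" for m
    using that distinguishable_le_covering[OF _ fin \<epsilon>] by blast
  have "?P 0" by (simp add: eps_distinguishable_def)
  then have P: "?P (packing_number a b \<epsilon> E)"
    unfolding packing_number_def using bound by (rule GreatestI_nat)
  then obtain y where y: "eps_distinguishable a b \<epsilon> E (packing_number a b \<epsilon> E) y" by blast
  have "\<not> ?P (Suc (packing_number a b \<epsilon> E))"
  proof
    assume "?P (Suc (packing_number a b \<epsilon> E))"
    then have "Suc (packing_number a b \<epsilon> E) \<le> packing_number a b \<epsilon> E"
      unfolding packing_number_def using bound by (rule Greatest_le_nat)
    then show False by simp
  qed
  then have c: "\<exists>Y. eps_covering a b \<epsilon> E (packing_number a b \<epsilon> E) Y"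
    using maximal_distinguishable_covering[OF y _ E \<epsilon>] by blast
  then show "covering_number a b \<epsilon> E \<le> packing_number a b \<epsilon> E"
    unfolding covering_number_def by (rule Least_le)
  show "\<exists>Y. eps_covering a b \<epsilon> E (covering_number a b \<epsilon> E) Y"
    unfolding covering_number_def using c by (rule LeastI)
  have "\<exists>Y. eps_covering a b (\<epsilon> / 2) E (covering_number a b (\<epsilon> / 2) E) Y"
    unfolding covering_number_def[of a b "\<epsilon> / 2"] by (rule LeastI_ex) (rule exI, rule exI, rule fin)
  then show "packing_number a b \<epsilon> E \<le> covering_number a b (\<epsilon> / 2) E"
    using distinguishable_le_covering[OF y _ \<epsilon>] by blast
  show "covering_number a b (\<epsilon> / 2) E \<le> n"
    unfolding covering_number_def using fin by (intro Least_le) blast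
qed

section \<open>Images of the unit ball under diagonal operators\<close>

text \<open>
  The volume and grid arguments see the operator only through its diagonal action on
  coefficients; self-adjointness and the eigenvalue equation enter only through \<open>A_coeff\<close>.
\<close>

locale l2_diagonal_operator =
  fixes a b :: real and A :: "(real \<Rightarrow> real) \<Rightarrow> real \<Rightarrow> real" and lam :: "nat \<Rightarrow> real"
    and \<psi> :: "nat \<Rightarrow> real \<Rightarrow> real"
  assumes basis: "l2_orthonormal_basis a b \<psi>"
    and A_L2: "f \<in> L2 a b \<Longrightarrow> A f \<in> L2 a b"
    and A_coeff: "f \<in> L2 a b \<Longrightarrow> k \<ge> 1 \<Longrightarrow> l2_inner a b (A f) (\<psi> k) = lam k * l2_inner a b f (\<psi> k)"
    and lam_pos: "k \<ge> 1 \<Longrightarrow> 0 < lam k"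
begin

lemma \<psi>_L2: "k \<ge> 1 \<Longrightarrow> \<psi> k \<in> L2 a b"
  using basis by (simp add: l2_orthonormal_basis_def)

lemma \<psi>_orthonormal: "j \<ge> 1 \<Longrightarrow> k \<ge> 1 \<Longrightarrow> l2_inner a b (\<psi> j) (\<psi> k) = (if j = k then 1 else 0)"
  using basis by (simp add: l2_orthonormal_basis_def)

lemma Bessel:
  assumes "f \<in> L2 a b" "finite I" "\<And>k. k \<in> I \<Longrightarrow> k \<ge> 1"
  shows "(\<Sum>k\<in>I. (l2_inner a b f (\<psi> k))\<^sup>2) \<le> l2_inner a b f f"
  using assms by (intro Bessel_inequality) (simp_all add: \<psi>_L2 \<psi>_orthonormal)

lemma unit_ball_image_L2: "unit_ball_image a b A \<subseteq> L2 a b"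
  using A_L2 by (auto simp: unit_ball_image_def)

lemma unit_ball_image_cases:
  assumes "g \<in> unit_ball_image a b A"
  obtains u where "g = A u" "u \<in> L2 a b" "l2_inner a b u u \<le> 1"
  using assms by (auto simp: unit_ball_image_def l2_norm_def)

text \<open>
  The preimage of the point \<open>x\<close> is \<open>\<Sum>k. (x k / lam k) \<psi> k\<close>, and the equation of the ellipsoid says
  that its norm is at most 1.
\<close>

lemma ellipsoid_subset_coordinates:
  assumes x: "x \<in> ellipsoid {1..n} lam"
  shows "\<exists>g\<in>unit_ball_image a b A. x = (\<lambda>i\<in>{1..n}. l2_inner a b g (\<psi> i))"
proof -
  define u where "u = (\<lambda>t. \<Sum>k=1..n. x k / lam k * \<psi> k t)"
  have u: "u \<in> L2 a b" unfolding u_def by (rule L2_lincomb) (auto intro: \<psi>_L2)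
  have inner: "l2_inner a b u h = (\<Sum>k=1..n. x k / lam k * l2_inner a b (\<psi> k) h)" if "h \<in> L2 a b" for h
    unfolding u_def by (rule l2_inner_lincomb_left) (auto intro: \<psi>_L2 that)
  have coord: "l2_inner a b u (\<psi> i) = x i / lam i" if "i \<in> {1..n}" for i
  proof -
    have "l2_inner a b u (\<psi> i) = (\<Sum>k=1..n. if k = i then x k / lam k else 0)"
    proof -
      have "x k / lam k * l2_inner a b (\<psi> k) (\<psi> i) = (if k = i then x k / lam k else 0)"
        if "k \<in> {1..n}" for k
        using that \<open>i \<in> {1..n}\<close> by (simp add: \<psi>_orthonormal)
      moreover have "\<psi> i \<in> L2 a b" using that by (simp add: \<psi>_L2)
      ultimately show ?thesis by (simp only: inner cong: sum.cong)
    qed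
    then show ?thesis using that by simp
  qed
  have "l2_inner a b u u = (\<Sum>k=1..n. (x k / lam k)\<^sup>2)"
    unfolding inner[OF u] power2_eq_square l2_inner_commute[of a b "\<psi> _" u]
    by (intro sum.cong) (simp_all add: coord)
  also have "\<dots> \<le> 1" using x by (simp add: ellipsoid_def)
  finally have "A u \<in> unit_ball_image a b A"
    using u by (auto simp: unit_ball_image_def l2_norm_def)
  moreover have "x = (\<lambda>i\<in>{1..n}. l2_inner a b (A u) (\<psi> i))"
  proof
    fix i
    show "x i = (\<lambda>i\<in>{1..n}. l2_inner a b (A u) (\<psi> i)) i"
    proof (cases "i \<in> {1..n}")
      case True
      then show ?thesis using lam_pos[of i] by (simp add: A_coeff[OF u] coord)
    next
      case False
      then show ?thesis using x by (auto simp: ellipsoid_def extensional_def)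
    qed
  qed
  ultimately show ?thesis by blast
qed

text \<open>
  Taking the first \<open>n\<close> coefficients does not increase distances, by Bessel's inequality, so a covering
  of the image of the unit ball projects to a covering of the \<open>n\<close>-dimensional ellipsoid by sets of no
  larger diameter.
\<close>

lemma covering_lower_bound:
  assumes Y: "eps_covering a b r (unit_ball_image a b A) N Y" and r: "r > 0"
  shows "(\<Prod>k=1..n. lam k) \<le> real N * r ^ n"
proof -
  define P where "P = (\<lambda>g. \<lambda>i\<in>{1..n}. l2_inner a b g (\<psi> i))"
  have "(\<Prod>k\<in>{1..n}. lam k) \<le> real (card {1..N}) * r ^ card {1..n}"
  proof (rule ellipsoid_cover_bound)
    show "ellipsoid {1..n} lam \<subseteq> (\<Union>k\<in>{1..N}. P ` Y k)"
    proof
      fix x assume "x \<in> ellipsoid {1..n} lam"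
      then obtain g where g: "g \<in> unit_ball_image a b A" "x = P g"
        using ellipsoid_subset_coordinates unfolding P_def by blast
      then show "x \<in> (\<Union>k\<in>{1..N}. P ` Y k)" using Y unfolding eps_covering_def by blast
    qed
    fix k x y assume k: "k \<in> {1..N}" "x \<in> P ` Y k" "y \<in> P ` Y k"
    then obtain f g where fg: "f \<in> Y k" "g \<in> Y k" "x = P f" "y = P g" by blast
    have "Y k \<subseteq> L2 a b" and "l2_diameter a b (Y k) \<le> ennreal (2 * r)"
      using Y k(1) by (simp_all add: eps_covering_def)
    then have L2: "f \<in> L2 a b" "g \<in> L2 a b" and d: "l2_dist a b f g \<le> 2 * r"
      using fg r by (auto simp: l2_diameter_le_iff)
    have "(\<Sum>i\<in>{1..n}. (x i - y i)\<^sup>2) = (\<Sum>i\<in>{1..n}. (l2_inner a b (\<lambda>t. f t - g t) (\<psi> i))\<^sup>2)"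
      by (intro sum.cong) (auto simp: fg P_def l2_inner_diff_left L2 \<psi>_L2)
    also have "\<dots> \<le> (l2_dist a b f g)\<^sup>2"
      unfolding l2_dist_def l2_norm_squared by (intro Bessel L2_diff L2) auto
    also have "\<dots> \<le> (2 * r)\<^sup>2" by (intro power_mono d l2_dist_nonneg)
    finally show "(\<Sum>i\<in>{1..n}. (x i - y i)\<^sup>2) \<le> (2 * r)\<^sup>2" .
  qed (auto simp: P_def r lam_pos)
  then show ?thesis by simp
qed

text \<open>
  Beyond the index \<open>n\<close> the operator contracts by the factor \<open>\<delta>\<close>, so only the first \<open>n\<close> coefficients of
  the image have to be controlled individually.
\<close>

lemma l2_dist_image_le:
  assumes u: "u \<in> L2 a b" "v \<in> L2 a b" and tail: "\<And>k. k > n \<Longrightarrow> lam k \<le> \<delta>" and \<delta>: "\<delta> \<ge> 0"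
  shows "(l2_dist a b (A u) (A v))\<^sup>2 \<le>
    (\<Sum>k=1..n. (l2_inner a b (A u) (\<psi> k) - l2_inner a b (A v) (\<psi> k))\<^sup>2) + \<delta>\<^sup>2 * (l2_dist a b u v)\<^sup>2"
proof -
  define w where "w = (\<lambda>x. u x - v x)"
  define g where "g = (\<lambda>x. A u x - A v x)"
  have w: "w \<in> L2 a b" and g: "g \<in> L2 a b"
    using u by (auto simp: w_def g_def intro: L2_diff A_L2)
  have gk: "l2_inner a b g (\<psi> k) = l2_inner a b (A u) (\<psi> k) - l2_inner a b (A v) (\<psi> k)" if "k \<ge> 1" for k
    unfolding g_def using that u by (intro l2_inner_diff_left A_L2 \<psi>_L2)
  have gw: "l2_inner a b g (\<psi> k) = lam k * l2_inner a b w (\<psi> k)" if "k \<ge> 1" for k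
    unfolding gk[OF that] w_def using that u
    by (simp add: A_coeff l2_inner_diff_left \<psi>_L2 right_diff_distrib)
  let ?head = "\<Sum>k=1..n. (l2_inner a b g (\<psi> k))\<^sup>2"
  have "(\<Sum>k=1..m. (l2_inner a b g (\<psi> k))\<^sup>2) \<le> ?head + \<delta>\<^sup>2 * l2_inner a b w w" if "m \<ge> n" for m
  proof -
    have split: "{1..m} = {1..n} \<union> {n<..m}" using that by auto
    have "(\<Sum>k=1..m. (l2_inner a b g (\<psi> k))\<^sup>2) = ?head + (\<Sum>k\<in>{n<..m}. (l2_inner a b g (\<psi> k))\<^sup>2)"
      unfolding split by (rule sum.union_disjoint) auto
    also have "(\<Sum>k\<in>{n<..m}. (l2_inner a b g (\<psi> k))\<^sup>2) \<le> (\<Sum>k\<in>{n<..m}. \<delta>\<^sup>2 * (l2_inner a b w (\<psi> k))\<^sup>2)"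
    proof (rule sum_mono)
      fix k assume k: "k \<in> {n<..m}"
      then have "(lam k)\<^sup>2 \<le> \<delta>\<^sup>2" using lam_pos[of k] by (intro power_mono tail) auto
      then show "(l2_inner a b g (\<psi> k))\<^sup>2 \<le> \<delta>\<^sup>2 * (l2_inner a b w (\<psi> k))\<^sup>2"
        using k by (simp add: gw power_mult_distrib mult_right_mono)
    qed
    also have "\<dots> = \<delta>\<^sup>2 * (\<Sum>k\<in>{n<..m}. (l2_inner a b w (\<psi> k))\<^sup>2)" by (simp add: sum_distrib_left)
    also have "\<dots> \<le> \<delta>\<^sup>2 * l2_inner a b w w" using w by (intro mult_left_mono Bessel) auto
    finally show ?thesis by simp
  qed
  then have "l2_inner a b g g \<le> ?head + \<delta>\<^sup>2 * l2_inner a b w w"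
    by (intro LIMSEQ_le_const2[OF Parseval_limit[OF basis g]]) blast
  also have "?head = (\<Sum>k=1..n. (l2_inner a b (A u) (\<psi> k) - l2_inner a b (A v) (\<psi> k))\<^sup>2)"
    by (intro sum.cong) (auto simp: gk)
  finally show ?thesis unfolding l2_dist_def l2_norm_squared w_def g_def .
qed

lemma unit_ball_image_coordinate_le:
  assumes g: "g \<in> unit_ball_image a b A" and k: "k \<ge> 1" and lam: "lam k \<le> 1"
  shows "\<bar>l2_inner a b g (\<psi> k)\<bar> \<le> 1"
proof -
  obtain u where u: "g = A u" "u \<in> L2 a b" "l2_inner a b u u \<le> 1"
    using g by (rule unit_ball_image_cases)
  have "(l2_inner a b u (\<psi> k))\<^sup>2 \<le> 1"
    using Bessel[OF u(2), of "{k}"] u(3) k by simp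
  then have "\<bar>l2_inner a b u (\<psi> k)\<bar> \<le> 1" by (simp add: abs_square_le_1)
  then have "lam k * \<bar>l2_inner a b u (\<psi> k)\<bar> \<le> 1 * 1"
    using lam lam_pos[OF k] by (intro mult_mono) auto
  then show ?thesis using lam_pos[OF k] by (simp add: u A_coeff[OF u(2) k] abs_mult)
qed

text \<open>
  Elements whose first \<open>n\<close> coefficients lie in the same grid cube of side \<open>s = \<epsilon> / (2 sqrt n)\<close> differ there by
  at most \<open>\<epsilon> / 2\<close> in norm, the diagonal of the cube. The remaining coefficients contribute at most
  \<open>(\<epsilon> / 4) * 2\<close>, the diameter of the unit ball being 2. The coefficients lie in \<open>[-1, 1]\<close>, so
  \<open>2 / s + 1 = 4 * sqrt n / \<epsilon> + 1 \<le> 6 * sqrt n / \<epsilon>\<close> intervals per coordinate suffice.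
\<close>

lemma covering_upper_bound:
  assumes \<epsilon>: "0 < \<epsilon>" "\<epsilon> \<le> 1" and n: "n \<ge> 1" and lam_le: "\<And>k. k \<ge> 1 \<Longrightarrow> lam k \<le> 1"
    and tail: "\<And>k. k > n \<Longrightarrow> lam k \<le> \<epsilon> / 4"
  shows "\<exists>N Y. eps_covering a b (\<epsilon> / 2) (unit_ball_image a b A) N Y \<and> real N \<le> (6 * sqrt n / \<epsilon>) ^ n"
proof -
  let ?E = "unit_ball_image a b A"
  define s where "s = \<epsilon> / (2 * sqrt n)"
  have s: "s > 0" using \<epsilon> n by (simp add: s_def)
  \<comment> \<open>Shifting by 1 makes the coefficients nonnegative, where \<open>nat\<close> of the floor is injective.\<close>
  define cell where "cell = (\<lambda>g. \<lambda>i\<in>{1..n}. nat \<lfloor>(l2_inner a b g (\<psi> i) + 1) / s\<rfloor>)"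
  define m where "m = nat \<lfloor>2 / s\<rfloor>"
  define V where "V = Pi\<^sub>E {1..n} (\<lambda>_. {0..m})"
  have V: "finite V" "card V = (m + 1) ^ n"
    by (auto simp: V_def card_PiE intro!: finite_PiE)
  have cell_V: "cell g \<in> V" if "g \<in> ?E" for g
  proof -
    have "nat \<lfloor>(l2_inner a b g (\<psi> i) + 1) / s\<rfloor> \<le> m" if "i \<in> {1..n}" for i
    proof -
      have "(l2_inner a b g (\<psi> i) + 1) / s \<le> 2 / s"
        using unit_ball_image_coordinate_le[OF \<open>g \<in> ?E\<close>, of i] that lam_le[of i] s
        by (intro divide_right_mono) auto
      then show ?thesis unfolding m_def by (intro nat_mono floor_mono)
    qed
    then show ?thesis by (auto simp: V_def cell_def)
  qed
  have close: "\<bar>l2_inner a b f (\<psi> i) - l2_inner a b g (\<psi> i)\<bar> \<le> s"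
    if "f \<in> ?E" "g \<in> ?E" "cell f = cell g" "i \<in> {1..n}" for f g i
  proof -
    let ?p = "(l2_inner a b f (\<psi> i) + 1) / s" and ?q = "(l2_inner a b g (\<psi> i) + 1) / s"
    have "0 \<le> ?p" "0 \<le> ?q"
      using unit_ball_image_coordinate_le[OF that(1), of i] unit_ball_image_coordinate_le[OF that(2), of i]
        that(4) lam_le[of i] s by auto
    moreover have "nat \<lfloor>?p\<rfloor> = nat \<lfloor>?q\<rfloor>"
      using fun_cong[OF that(3), of i] that(4) by (simp add: cell_def)
    ultimately have "\<lfloor>?p\<rfloor> = \<lfloor>?q\<rfloor>" by (simp add: eq_nat_nat_iff)
    then have "\<bar>?p - ?q\<bar> \<le> 1" by linarith
    moreover have "?p - ?q = (l2_inner a b f (\<psi> i) - l2_inner a b g (\<psi> i)) / s"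
      by (simp add: diff_divide_distrib add_divide_distrib)
    ultimately show ?thesis using s by (simp add: abs_divide)
  qed
  obtain h where h: "bij_betw h {1..card V} V" using ex_bij_betw_nat_finite_1[OF V(1)] by blast
  define Y where "Y = (\<lambda>k. {g \<in> ?E. cell g = h k})"
  have "eps_covering a b (\<epsilon> / 2) ?E (card V) Y"
    unfolding eps_covering_def
  proof (intro conjI ballI)
    fix k
    show "Y k \<subseteq> L2 a b" using unit_ball_image_L2 by (auto simp: Y_def)
    have "l2_dist a b f g \<le> \<epsilon>" if fg: "f \<in> Y k" "g \<in> Y k" for f g
    proof -
      have E: "f \<in> ?E" "g \<in> ?E" "cell f = cell g" using fg by (auto simp: Y_def)
      obtain u where u: "f = A u" "u \<in> L2 a b" "l2_inner a b u u \<le> 1"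
        using E(1) by (rule unit_ball_image_cases)
      obtain v where v: "g = A v" "v \<in> L2 a b" "l2_inner a b v v \<le> 1"
        using E(2) by (rule unit_ball_image_cases)
      have "(l2_dist a b u v)\<^sup>2 \<le> 4"
        unfolding l2_dist_def l2_norm_squared using l2_inner_diff_self_le[OF u(2) v(2)] u(3) v(3) by linarith
      then have t: "(\<epsilon> / 4)\<^sup>2 * (l2_dist a b u v)\<^sup>2 \<le> (\<epsilon> / 4)\<^sup>2 * 4"
        by (intro mult_left_mono) auto
      have "(\<Sum>i=1..n. (l2_inner a b f (\<psi> i) - l2_inner a b g (\<psi> i))\<^sup>2) \<le> (\<Sum>i=1..n. s\<^sup>2)"
        using close[OF E] s by (intro sum_mono) (simp add: abs_le_square_iff[symmetric])
      also have "\<dots> = \<epsilon>\<^sup>2 / 4" using n by (simp add: s_def power_divide power_mult_distrib)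
      finally have "(l2_dist a b f g)\<^sup>2 \<le> \<epsilon>\<^sup>2 / 4 + (\<epsilon> / 4)\<^sup>2 * 4"
        using l2_dist_image_le[where n = n and \<delta> = "\<epsilon> / 4", OF u(2) v(2) tail] \<epsilon> t
        unfolding u(1) v(1) by linarith
      also have "\<dots> \<le> \<epsilon>\<^sup>2" by (simp add: power_divide)
      finally show ?thesis by (rule power2_le_imp_le) (use \<epsilon> in simp)
    qed
    then show "l2_diameter a b (Y k) \<le> ennreal (2 * (\<epsilon> / 2))"
      using \<epsilon> by (subst l2_diameter_le_iff) auto
  next
    show "?E \<subseteq> (\<Union>k\<in>{1..card V}. Y k)"
    proof
      fix g assume g: "g \<in> ?E"
      then obtain k where "k \<in> {1..card V}" "h k = cell g"
        using cell_V[OF g] h by (metis (no_types, lifting) bij_betw_imp_surj_on imageE)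
      moreover from this g have "g \<in> Y k" by (simp add: Y_def)
      ultimately show "g \<in> (\<Union>k\<in>{1..card V}. Y k)" by blast
    qed
  qed
  moreover have "real (card V) \<le> (6 * sqrt n / \<epsilon>) ^ n"
  proof -
    have "1 \<le> sqrt n / \<epsilon>" using \<epsilon> n by (simp add: le_divide_eq order_trans[of \<epsilon> 1])
    moreover have "real m \<le> 4 * (sqrt n / \<epsilon>)"
    proof -
      have "real m \<le> 2 / s" using s by (simp add: m_def)
      also have "\<dots> = 4 * (sqrt n / \<epsilon>)" by (simp add: s_def)
      finally show ?thesis .
    qed
    ultimately have "real (m + 1) \<le> 6 * sqrt n / \<epsilon>" by simp
    then show ?thesis unfolding V of_nat_power by (intro power_mono) auto
  qed
  ultimately show ?thesis by blast
qed

end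

section \<open>Entropy and capacity bounds\<close>

lemma k0_pos_and_greatest:
  fixes lam :: "nat \<Rightarrow> real"
  assumes lim: "lam \<longlonglongrightarrow> 0" and \<delta>: "0 < \<delta>" "\<delta> \<le> lam 1"
  shows "k0 lam \<delta> \<ge> 1" "\<And>k. k > k0 lam \<delta> \<Longrightarrow> lam k < \<delta>"
proof -
  let ?P = "\<lambda>k. k \<ge> 1 \<and> lam k \<ge> \<delta>"
  from order_tendstoD(2)[OF lim \<delta>(1)] obtain K where K: "\<And>k. k \<ge> K \<Longrightarrow> lam k < \<delta>"
    by (auto simp: eventually_sequentially)
  have bound: "k \<le> K" if "?P k" for k using that K[of k] by (cases "k \<le> K") auto
  have "?P 1" using \<delta> by simp
  then have "?P (k0 lam \<delta>)" unfolding k0_def using bound by (rule GreatestI_nat)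
  then show "k0 lam \<delta> \<ge> 1" by simp
  show "lam k < \<delta>" if "k > k0 lam \<delta>" for k
  proof (rule ccontr)
    assume "\<not> lam k < \<delta>"
    then have "?P k" using that by simp
    then have "k \<le> k0 lam \<delta>" unfolding k0_def using bound by (rule Greatest_le_nat)
    with that show False by simp
  qed
qed

theorem mainTheorem1:
  fixes a b :: real
    and A :: "(real \<Rightarrow> real) \<Rightarrow> (real \<Rightarrow> real)"
    and lam :: "nat \<Rightarrow> real"
    and \<psi> :: "nat \<Rightarrow> real \<Rightarrow> real"
  assumes "a < b"
    and "l2_linear a b A"
    and "l2_self_adjoint a b A"
    and "l2_compact a b A"
    and "l2_injective a b A"
    and "{\<mu>. l2_eigenvalue a b A \<mu>} = lam ` {1..}"
    and "\<And>k. k \<ge> 1 \<Longrightarrow> l2_simple_eigenvalue a b A (lam k)"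
    and "lam 1 \<le> 1"
    and "\<And>k. k \<ge> 1 \<Longrightarrow> lam (Suc k) < lam k"
    and "\<And>k. k \<ge> 1 \<Longrightarrow> 0 < lam k"
    and "lam \<longlonglongrightarrow> 0"
    and "\<And>k. k \<ge> 1 \<Longrightarrow> l2_eigenfunction a b A (lam k) (\<psi> k)"
    and "l2_orthonormal_basis a b \<psi>"
  shows "\<forall>\<epsilon>. 0 < \<epsilon> \<and> \<epsilon> < lam 1 \<longrightarrow>
    (let E = unit_ball_image a b A;
         lower = (\<Sum>k=1..k0 lam \<epsilon>. log 2 (lam k / \<epsilon>));
         upper = real (k0 lam (\<epsilon> / 4)) *
                   (log 2 (1 / \<epsilon>) + log 2 6 + 1 / 2 * log 2 (real (k0 lam (\<epsilon> / 4))))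
     in lower \<le> eps_entropy a b \<epsilon> E \<and>
        eps_entropy a b (\<epsilon> / 2) E \<le> upper \<and>
        lower \<le> eps_capacity a b \<epsilon> E \<and>
        eps_capacity a b \<epsilon> E \<le> upper)"
proof (intro allI impI)
  fix \<epsilon> :: real assume \<epsilon>: "0 < \<epsilon> \<and> \<epsilon> < lam 1"
  interpret l2_diagonal_operator a b A lam \<psi>
  proof
    show "l2_orthonormal_basis a b \<psi>" by fact
    show A_L2: "A f \<in> L2 a b" if "f \<in> L2 a b" for f
      using that assms(2) by (simp add: l2_linear_def)
    show "l2_inner a b (A f) (\<psi> k) = lam k * l2_inner a b f (\<psi> k)" if "f \<in> L2 a b" "k \<ge> 1" for f k
    proof -
      have \<psi>: "\<psi> k \<in> L2 a b" "l2_eq a b (A (\<psi> k)) (\<lambda>x. lam k * \<psi> k x)"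
        using assms(12)[OF that(2)] by (simp_all add: l2_eigenfunction_def)
      have "l2_inner a b (A f) (\<psi> k) = l2_inner a b f (A (\<psi> k))"
        using assms(3) that \<psi> by (simp add: l2_self_adjoint_def)
      also have "\<dots> = l2_inner a b f (\<lambda>x. lam k * \<psi> k x)"
        using \<psi> that by (intro l2_inner_cong A_L2 L2_scale)
      finally show ?thesis by (simp add: l2_inner_scale_right)
    qed
  qed (rule assms(10))
  let ?E = "unit_ball_image a b A"
  have antimono: "lam j \<le> lam i" if "1 \<le> i" "i \<le> j" for i j
    using that(2)
  proof (induction j rule: dec_induct)
    case (step j)
    then show ?case using assms(9)[of j] that(1) by simp
  qed simp
  define p where "p = k0 lam \<epsilon>"
  define q where "q = k0 lam (\<epsilon> / 4)"
  have q: "q \<ge> 1" "\<And>k. k > q \<Longrightarrow> lam k \<le> \<epsilon> / 4"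
    using k0_pos_and_greatest[OF assms(11), of "\<epsilon> / 4"] \<epsilon> by (auto simp: q_def less_imp_le)
  have lam1: "lam k \<le> 1" if "k \<ge> 1" for k using antimono[of 1 k] that assms(8) by simp
  obtain N Y where NY: "eps_covering a b (\<epsilon> / 2) ?E N Y" and N: "real N \<le> (6 * sqrt q / \<epsilon>) ^ q"
    using covering_upper_bound[of \<epsilon> q] \<epsilon> assms(8) q lam1 by auto
  note sandwich = covering_packing_sandwich[OF unit_ball_image_L2 _ NY]
  let ?H = "covering_number a b \<epsilon> ?E" and ?C = "packing_number a b \<epsilon> ?E"
    and ?H2 = "covering_number a b (\<epsilon> / 2) ?E"
  have le: "?H \<le> ?C" "?C \<le> ?H2" "?H2 \<le> N" using sandwich \<epsilon> by auto
  obtain Z where "eps_covering a b \<epsilon> ?E ?H Z" using sandwich(4) \<epsilon> by auto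
  then have prod_le: "(\<Prod>k=1..p. lam k) \<le> real ?H * \<epsilon> ^ p"
    using \<epsilon> by (intro covering_lower_bound) auto
  have pos: "(\<Prod>k=1..p. lam k) > 0" by (intro prod_pos) (auto intro: lam_pos)
  have H: "?H > 0" using prod_le pos by (cases "?H = 0") auto
  \<comment> \<open>The volume estimate in dimension \<open>p\<close>; the cut at \<open>lam k \<ge> \<epsilon>\<close> keeps exactly the nonnegative summands.\<close>
  have lower: "(\<Sum>k=1..p. log 2 (lam k / \<epsilon>)) \<le> log 2 ?H"
  proof -
    have lam_nz: "lam k \<noteq> 0" if "Suc 0 \<le> k" for k using lam_pos[of k] that by simp
    have "(\<Sum>k=1..p. log 2 (lam k / \<epsilon>)) = log 2 (\<Prod>k=1..p. lam k / \<epsilon>)"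
      unfolding log_def sum_divide_distrib[symmetric]
      by (subst ln_prod) (use \<epsilon> in \<open>auto simp: lam_nz\<close>)
    also have "\<dots> = log 2 ((\<Prod>k=1..p. lam k) / \<epsilon> ^ p)" by (simp add: prod_dividef)
    also have "\<dots> \<le> log 2 ?H"
      using \<epsilon> pos prod_le by (intro log_mono) (auto simp: divide_le_eq)
    finally show ?thesis .
  qed
  have upper: "log 2 ?H2 \<le> real q * (log 2 (1 / \<epsilon>) + log 2 6 + 1 / 2 * log 2 (real q))"
  proof -
    have "log 2 ?H2 \<le> log 2 ((6 * sqrt q / \<epsilon>) ^ q)"
      using H le N by (intro log_mono) auto
    also have "\<dots> = real q * log 2 (6 * sqrt q / \<epsilon>)" using \<epsilon> q by (intro log_nat_power) auto
    also have "log 2 (6 * sqrt q / \<epsilon>) = log 2 (1 / \<epsilon>) + log 2 6 + 1 / 2 * log 2 (real q)"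
      using \<epsilon> q(1) by (simp add: log_def ln_mult ln_div ln_sqrt add_divide_distrib diff_divide_distrib)
    finally show ?thesis .
  qed
  have mid: "log 2 ?H \<le> log 2 ?C" "log 2 ?C \<le> log 2 ?H2"
    using H le by (auto intro!: log_mono)
  show "let E = unit_ball_image a b A;
         lower = (\<Sum>k=1..k0 lam \<epsilon>. log 2 (lam k / \<epsilon>));
         upper = real (k0 lam (\<epsilon> / 4)) *
                   (log 2 (1 / \<epsilon>) + log 2 6 + 1 / 2 * log 2 (real (k0 lam (\<epsilon> / 4))))
     in lower \<le> eps_entropy a b \<epsilon> E \<and>
        eps_entropy a b (\<epsilon> / 2) E \<le> upper \<and>
        lower \<le> eps_capacity a b \<epsilon> E \<and>
        eps_capacity a b \<epsilon> E \<le> upper"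
    unfolding Let_def eps_entropy_def eps_capacity_def p_def[symmetric] q_def[symmetric]
    using lower upper mid by linarith
qed

end
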